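(* Let $k$ be an integer with $k\geq 2$, and let $G$ be a simple graph with $n = |V(G)|$, girth $g = g(G)$ and minimum degree $\delta = \delta(G) \geq k$. Let $n_1^* = n_1^*(\delta,g)$. Each of the following holds. (i) If $\lambda_{2}(G)\leq \delta-\frac{(k-1)n}{n_{1}^{*}(n-n_{1}^{*})}$, then $\kappa'(G)\geq k$. (ii) If $\mu_{n-1}(G)\geq \frac{(k-1)n}{n_{1}^{*}(n-n_{1}^{*})}$, then $\kappa'(G)\geq k$. (iii) If $q_{2}(G)\leq 2\delta-\frac{(k-1)n}{n_{1}^{*}(n-n_{1}^{*})}$, then $\kappa'(G)\geq k$.
   Context: All graphs are finite and simple. $\kappa'(G)$ denotes the edge-connectivity of $G$. For a graph $G$ with adjacency matrix $A$ and diagonal degree matrix $D$, $\lambda_i(G)$, $\mu_i(G)$ and $q_i(G)$ denote the $i$th largest eigenvalue (with multiplicity) of $A$, of the Laplacian matrix $D-A$, and of the signless Laplacian matrix $D+A$, respectively. The girth of $G$ is the length of a shortest cycle of $G$ (finite here, since $\delta\ge 2$). For integers $\delta>0$ and $g\ge 3$, put $t=\lfloor \frac{g-1}{2}\rfloor$ and $$n_1^*=n_1^*(\delta,g)=\begin{cases}1+\delta+\sum_{i=2}^{t}(\delta-1)^{i}, & \text{if } g=2t+1,\\ 2+2(\delta-1)^{t}+\sum_{i=1}^{t-1}(\delta-1)^{i}, & \text{if } g=2t+2,\end{cases}$$ where empty sums are $0$. *)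

theory Defs
  imports
    "Graph_Theory.Graph_Theory"
    "Jordan_Normal_Form.Char_Poly"
begin

text \<open>
  A finite simple graph is a \<^locale>\<open>pair_graph\<close>: a finite vertex set with a symmetric,
  irreflexive arc relation. An undirected edge is represented there by its two opposite arcs,
  so the degree of a vertex is its out-degree.
\<close>

definition min_degree :: "'a pair_pre_digraph \<Rightarrow> nat" where
  "min_degree G = Min ((\<lambda>v. out_degree (with_proj G) v) ` pverts G)"

text \<open>
  Traversing one edge back and forth is a \<open>cycle\<close> of length 2 for the library; the cycles of
  the undirected graph are those of length at least 3. The value for a forest is
  \<open>Inf {} = 0\<close>.
\<close>

definition girth :: "'a pair_pre_digraph \<Rightarrow> nat" where
  "girth G = Inf {length p |p. pre_digraph.cycle (with_proj G) p \<and> 3 \<le> length p}"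

definition edges :: "'a pair_pre_digraph \<Rightarrow> 'a set set" where
  "edges G = {{u, v} |u v. (u, v) \<in> parcs G}"

definition del_edges :: "'a pair_pre_digraph \<Rightarrow> 'a set set \<Rightarrow> 'a pair_pre_digraph" where
  "del_edges G F = G\<lparr>parcs := {(u, v) \<in> parcs G. {u, v} \<notin> F}\<rparr>"

text \<open>
  The minimum number of edges whose removal disconnects the graph; the one-vertex graph,
  which cannot be disconnected, gets \<open>Inf {} = 0\<close>.
\<close>

definition edge_connectivity :: "'a pair_pre_digraph \<Rightarrow> nat" where
  "edge_connectivity G =
     Inf {card F |F. F \<subseteq> edges G \<and> \<not> connected (with_proj (del_edges G F))}"

text \<open>
  Matrices are indexed by \<open>{0..<n}\<close>, so an arbitrary enumeration of the vertices is fixed.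
  Another choice conjugates all matrices below by the same permutation matrix and
  leaves their spectra unchanged.
\<close>

definition vertex_list :: "'a pair_pre_digraph \<Rightarrow> 'a list" where
  "vertex_list G = (SOME vs. distinct vs \<and> set vs = pverts G)"

definition adjacency_matrix :: "'a pair_pre_digraph \<Rightarrow> real mat" where
  "adjacency_matrix G = (let n = card (pverts G); vs = vertex_list G in
     mat n n (\<lambda>(i, j). if (vs ! i, vs ! j) \<in> parcs G then 1 else 0))"

definition degree_matrix :: "'a pair_pre_digraph \<Rightarrow> real mat" where
  "degree_matrix G = (let n = card (pverts G); vs = vertex_list G in
     mat n n (\<lambda>(i, j). if i = j then real (out_degree (with_proj G) (vs ! i)) else 0))"

definition laplacian_matrix :: "'a pair_pre_digraph \<Rightarrow> real mat" where
  "laplacian_matrix G = degree_matrix G - adjacency_matrix G"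

definition signless_laplacian_matrix :: "'a pair_pre_digraph \<Rightarrow> real mat" where
  "signless_laplacian_matrix G = degree_matrix G + adjacency_matrix G"

text \<open>
  The \<open>i\<close>-th largest real eigenvalue, counted from \<open>i = 1\<close> and with multiplicity as a root of
  the characteristic polynomial. It is only applied to real symmetric matrices, whose
  characteristic polynomials split over the reals.
\<close>

definition nth_largest_eigenvalue :: "real mat \<Rightarrow> nat \<Rightarrow> real" where
  "nth_largest_eigenvalue A i =
     rev (sorted_list_of_multiset (proots (char_poly A))) ! (i - 1)"

definition adj_eigenvalue :: "'a pair_pre_digraph \<Rightarrow> nat \<Rightarrow> real" where
  "adj_eigenvalue G i = nth_largest_eigenvalue (adjacency_matrix G) i"

definition lap_eigenvalue :: "'a pair_pre_digraph \<Rightarrow> nat \<Rightarrow> real" where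
  "lap_eigenvalue G i = nth_largest_eigenvalue (laplacian_matrix G) i"

definition signless_lap_eigenvalue :: "'a pair_pre_digraph \<Rightarrow> nat \<Rightarrow> real" where
  "signless_lap_eigenvalue G i = nth_largest_eigenvalue (signless_laplacian_matrix G) i"

text \<open>Intended for \<open>\<delta> > 0\<close> and \<open>g \<ge> 3\<close>, where no subtraction truncates.\<close>

definition n1_star :: "nat \<Rightarrow> nat \<Rightarrow> nat" where
  "n1_star \<delta> g = (let t = (g - 1) div 2 in
     if g = 2 * t + 1 then 1 + \<delta> + (\<Sum>i = 2..t. (\<delta> - 1) ^ i)
     else 2 + 2 * (\<delta> - 1) ^ t + (\<Sum>i = 1..t - 1. (\<delta> - 1) ^ i))"

end

theory Submission
  imports Defs "Jordan_Normal_Form.Schur_Decomposition"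
begin

text \<open>
  Suppose that deleting fewer than \<open>k \<le> \<delta>\<close> edges separates \<open>X\<close> from its complement \<open>Y\<close>.
  A side with fewer than \<open>\<delta>\<close> edges leaving it contains an interior vertex, one whose neighbours
  all lie on that side; growing the non-backtracking walks from an interior vertex (for even girth,
  from an edge between two interior vertices) gives \<open>|X|, |Y| \<ge> n\<^sub>1\<^sup>*\<close>.
  On the plane of vectors constant on \<open>X\<close> and on \<open>Y\<close>, the quadratic form of \<open>\<alpha>D + \<beta>A\<close> is
  the form of \<open>(\<alpha> + \<beta>)D\<close> minus \<open>\<beta> e(X, Y) (p - q)\<^sup>2\<close>, so it is on the wrong side of the assumed
  eigenvalue bound. At most one eigenvalue lies beyond the threshold, so the plane meets the span of
  the other eigenvectors; there the two bounds force an eigenvector for the threshold itself.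
  The eigenvalue equation at an interior vertex of \<open>X\<close> and at one of \<open>Y\<close> makes it zero.
\<close>

section \<open>Symmetric real matrices\<close>

lemma symmetric_scalar_prod:
  fixes A :: "'a :: comm_ring_1 mat"
  assumes "A \<in> carrier_mat n n" "transpose_mat A = A" "x \<in> carrier_vec n" "y \<in> carrier_vec n"
  shows "x \<bullet> (A *\<^sub>v y) = y \<bullet> (A *\<^sub>v x)"
proof -
  have "x \<bullet> (A *\<^sub>v y) = (A *\<^sub>v y) \<bullet> x"
    using assms by (intro comm_scalar_prod[of _ n]) auto
  also have "\<dots> = y \<bullet> (transpose_mat A *\<^sub>v x)"
    using assms by (metis transpose_vec_mult_scalar)
  finally show ?thesis using assms by simp
qed

lemma scalar_prod_self_pos:
  fixes v :: "real vec"
  assumes "v \<in> carrier_vec n" "v \<noteq> 0\<^sub>v n"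
  shows "v \<bullet> v > 0"
  using conjugate_square_greater_0_vec[OF assms(1)] assms(2) by simp

lemma real_part_mult_mat_vec:
  assumes "A \<in> carrier_mat n n" "v \<in> carrier_vec n"
  shows "map_vec Re (map_mat complex_of_real A *\<^sub>v v) = A *\<^sub>v map_vec Re v"
    and "map_vec Im (map_mat complex_of_real A *\<^sub>v v) = A *\<^sub>v map_vec Im v"
  using assms by (auto intro!: eq_vecI simp: scalar_prod_def)

text \<open>The characteristic polynomial splits over the complex numbers, which yields an
  eigenvector \<open>w = x + iy\<close> with eigenvalue \<open>z\<close>. Symmetry, applied to the
  pair \<open>x\<close>, \<open>y\<close>, turns into
  \<open>Im z * (x \<bullet> x + y \<bullet> y) = 0\<close>, so \<open>z\<close> is real and
  whichever of \<open>x\<close>, \<open>y\<close> is nonzero is a real eigenvector.\<close>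

lemma symmetric_real_eigenvector:
  fixes A :: "real mat"
  assumes A: "A \<in> carrier_mat n n" and sym: "transpose_mat A = A" and n: "n > 0"
  obtains v e where "v \<in> carrier_vec n" "v \<bullet> v = 1" "A *\<^sub>v v = e \<cdot>\<^sub>v v"
proof -
  let ?C = "map_mat complex_of_real A"
  have C: "?C \<in> carrier_mat n n" using A by simp
  obtain as where as: "char_poly ?C = (\<Prod>a\<leftarrow>as. [:- a, 1:])" "length as = n"
    using char_poly_factorized[OF C] by blast
  then obtain z zs where "as = z # zs" using n by (cases as) auto
  then have "poly (char_poly ?C) z = 0" using as by simp
  then obtain w where w: "w \<in> carrier_vec n" "w \<noteq> 0\<^sub>v n" "?C *\<^sub>v w = z \<cdot>\<^sub>v w"
    using eigenvalue_root_char_poly[OF C] C unfolding eigenvalue_def eigenvector_def by auto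
  define x where "x = map_vec Re w"
  define y where "y = map_vec Im w"
  have xy: "x \<in> carrier_vec n" "y \<in> carrier_vec n" using w by (auto simp: x_def y_def)
  have Ax: "A *\<^sub>v x = Re z \<cdot>\<^sub>v x - Im z \<cdot>\<^sub>v y"
    unfolding x_def real_part_mult_mat_vec(1)[OF A w(1), symmetric] w(3) y_def
    using w(1) by (intro Matrix.eq_vecI) auto
  have Ay: "A *\<^sub>v y = Im z \<cdot>\<^sub>v x + Re z \<cdot>\<^sub>v y"
    unfolding y_def real_part_mult_mat_vec(2)[OF A w(1), symmetric] w(3) x_def
    using w(1) by (intro Matrix.eq_vecI) auto
  have "x \<noteq> 0\<^sub>v n \<or> y \<noteq> 0\<^sub>v n"
  proof (rule ccontr)
    assume "\<not> ?thesis"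
    then have "x $ i = 0 \<and> y $ i = 0" if "i < n" for i using that by simp
    then have "w = 0\<^sub>v n" using w(1) by (intro Matrix.eq_vecI) (auto simp: x_def y_def complex_eq_iff)
    with w show False by simp
  qed
  have "x \<bullet> (A *\<^sub>v y) = y \<bullet> (A *\<^sub>v x)" by (rule symmetric_scalar_prod[OF A sym xy])
  moreover have "x \<bullet> (A *\<^sub>v y) = Im z * (x \<bullet> x) + Re z * (x \<bullet> y)"
    unfolding Ay using xy by (subst scalar_prod_add_distrib[of _ n]) auto
  moreover have "y \<bullet> (A *\<^sub>v x) = Re z * (y \<bullet> x) - Im z * (y \<bullet> y)"
    unfolding Ax using xy by (subst scalar_prod_minus_distrib[of _ n]) auto
  moreover have "y \<bullet> x = x \<bullet> y" using xy by (metis comm_scalar_prod)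
  ultimately have "Im z * (x \<bullet> x + y \<bullet> y) = 0" by (simp add: algebra_simps)
  moreover have "x \<bullet> x + y \<bullet> y > 0"
  proof -
    have "x \<bullet> x \<ge> 0" "y \<bullet> y \<ge> 0" by (auto simp: scalar_prod_def intro!: sum_nonneg)
    then show ?thesis
      using \<open>x \<noteq> 0\<^sub>v n \<or> y \<noteq> 0\<^sub>v n\<close> scalar_prod_self_pos xy by (metis add_nonneg_pos add_pos_nonneg)
  qed
  ultimately have "Im z = 0" by simp
  have "\<exists>u \<in> carrier_vec n. u \<noteq> 0\<^sub>v n \<and> A *\<^sub>v u = Re z \<cdot>\<^sub>v u"
  proof (cases "x = 0\<^sub>v n")
    case True
    then have "y \<noteq> 0\<^sub>v n" using \<open>x \<noteq> 0\<^sub>v n \<or> y \<noteq> 0\<^sub>v n\<close> by simp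
    moreover have "A *\<^sub>v y = Re z \<cdot>\<^sub>v y" unfolding Ay \<open>Im z = 0\<close> using xy by (intro eq_vecI) auto
    ultimately show ?thesis using xy by blast
  next
    case False
    moreover have "A *\<^sub>v x = Re z \<cdot>\<^sub>v x" unfolding Ax \<open>Im z = 0\<close> using xy by (intro eq_vecI) auto
    ultimately show ?thesis using xy by blast
  qed
  then obtain u where u: "u \<in> carrier_vec n" "u \<noteq> 0\<^sub>v n" "A *\<^sub>v u = Re z \<cdot>\<^sub>v u" by blast
  define c where "c = 1 / sqrt (u \<bullet> u)"
  have "c * c * (u \<bullet> u) = 1" using scalar_prod_self_pos[OF u(1,2)] by (simp add: c_def)
  show thesis
  proof (rule that[of "c \<cdot>\<^sub>v u" "Re z"])
    show "c \<cdot>\<^sub>v u \<in> carrier_vec n" using u by simp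
    show "(c \<cdot>\<^sub>v u) \<bullet> (c \<cdot>\<^sub>v u) = 1" using \<open>c * c * (u \<bullet> u) = 1\<close> u by (simp add: mult.assoc)
    show "A *\<^sub>v (c \<cdot>\<^sub>v u) = Re z \<cdot>\<^sub>v (c \<cdot>\<^sub>v u)"
      using u A by (simp add: mult_mat_vec smult_smult_assoc mult.commute)
  qed
qed

text \<open>Gram-Schmidt, run on a basis that begins with \<open>v\<close>, keeps \<open>v\<close>
  in front; as \<open>v\<close> is a unit vector, the final normalisation fixes it too.\<close>

lemma orthogonal_matrix_with_first_column:
  fixes v :: "real vec"
  assumes v: "v \<in> carrier_vec n" "v \<bullet> v = 1" and n: "n > 0"
  obtains W where "W \<in> carrier_mat n n" "transpose_mat W * W = 1\<^sub>m n" "col W 0 = v"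
proof -
  interpret cof_vec_space n "TYPE(real)" .
  have v0: "v \<noteq> 0\<^sub>v n" using v by auto
  define b where "b = basis_completion v"
  define ws where "ws = gram_schmidt n b"
  note bc = basis_completion[OF v(1) v0, folded b_def]
  have b: "b = v # tl b" using bc n by (cases b) auto
  have ws: "set ws \<subseteq> carrier_vec n" "corthogonal ws" "length ws = n"
    using gram_schmidt_result[OF bc(2) bc(4) bc(5) refl] bc(6) by (auto simp: ws_def)
  have hd: "hd ws = v" unfolding ws_def by (subst b) (rule gram_schmidt_hd[OF v(1)])
  then have ws0: "ws ! 0 = v" using ws n by (cases ws) auto
  have wi: "ws ! i \<in> carrier_vec n" if "i < n" for i using ws that by auto
  define c where "c = (\<lambda>i. 1 / sqrt (ws ! i \<bullet> ws ! i))"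
  define W where "W = mat_of_cols n (map (\<lambda>i. c i \<cdot>\<^sub>v ws ! i) [0..<n])"
  have W: "W \<in> carrier_mat n n" by (simp add: W_def mat_of_cols_def)
  have colW: "col W i = c i \<cdot>\<^sub>v ws ! i" if "i < n" for i
    unfolding W_def using that wi by (subst col_mat_of_cols) auto
  have orth: "ws ! i \<bullet> ws ! j = 0 \<longleftrightarrow> i \<noteq> j" if "i < n" "j < n" for i j
    using corthogonalD[OF ws(2), of i j] that ws by simp
  show thesis
  proof (rule that[OF W])
    show "transpose_mat W * W = 1\<^sub>m n"
    proof (rule eq_matI)
      fix i j assume "i < dim_row (1\<^sub>m n)" "j < dim_col (1\<^sub>m n)"
      then have ij: "i < n" "j < n" by auto
      have "(transpose_mat W * W) $$ (i, j) = col W i \<bullet> col W j" using W ij by simp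
      also have "\<dots> = c i * c j * (ws ! i \<bullet> ws ! j)"
        using colW ij wi[OF ij(1)] wi[OF ij(2)] by (simp add: smult_scalar_prod_distrib[of _ n])
      also have "\<dots> = 1\<^sub>m n $$ (i, j)"
      proof (cases "i = j")
        case True
        have "ws ! i \<bullet> ws ! i > 0"
          using orth[OF ij(1) ij(1)] wi[OF ij(1)] by (metis less_eq_real_def scalar_prod_self_pos scalar_prod_left_zero)
        with True ij show ?thesis by (simp add: c_def)
      qed (use orth ij in auto)
      finally show "(transpose_mat W * W) $$ (i, j) = 1\<^sub>m n $$ (i, j)" .
    qed (use W in auto)
    show "col W 0 = v" using colW[OF n] ws0 v by (simp add: c_def)
  qed
qed

text \<open>Deflation: in an orthonormal basis that begins with a unit eigenvector the matrix splits
  into a corner entry and a smaller symmetric block, to which the induction hypothesis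
  applies.\<close>

theorem orthogonal_diagonalization:
  fixes A :: "real mat"
  assumes "A \<in> carrier_mat n n" "transpose_mat A = A"
  shows "\<exists>P f. P \<in> carrier_mat n n \<and> transpose_mat P * P = 1\<^sub>m n \<and>
    transpose_mat P * A * P = mat_diag n f"
  using assms
proof (induction n arbitrary: A)
  case 0
  then show ?case by (intro exI[of _ "1\<^sub>m 0"] exI[of _ "\<lambda>_. 0"]) (auto intro!: eq_matI simp: mat_diag_def)
next
  case (Suc m)
  note A = Suc.prems(1) and sym = Suc.prems(2)
  obtain v e where v: "v \<in> carrier_vec (Suc m)" "v \<bullet> v = 1" "A *\<^sub>v v = e \<cdot>\<^sub>v v"
    using symmetric_real_eigenvector[OF A sym] by blast
  obtain W where W: "W \<in> carrier_mat (Suc m) (Suc m)" "transpose_mat W * W = 1\<^sub>m (Suc m)"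
    "col W 0 = v"
    using orthogonal_matrix_with_first_column[OF v(1,2)] by blast
  have WT: "transpose_mat W \<in> carrier_mat (Suc m) (Suc m)" using W by simp
  define B where "B = transpose_mat W * A * W"
  have B: "B \<in> carrier_mat (Suc m) (Suc m)" using W A by (simp add: B_def)
  have symB: "transpose_mat B = B"
    unfolding B_def using W(1) A sym WT
    by (subst transpose_mult[of _ "Suc m" "Suc m"])
      (auto simp: transpose_mult[OF WT A] assoc_mult_mat[OF WT A W(1)])
  \<comment> \<open>\<open>A\<close> maps the first column of \<open>W\<close> to a multiple of
    itself, and the other columns are orthogonal to it, so only the corner entry survives.\<close>
  have B0: "B $$ (i, 0) = (if i = 0 then e else 0)" if "i < Suc m" for i
  proof -
    have "B $$ (i, 0) = (transpose_mat W * (A * W)) $$ (i, 0)"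
      unfolding B_def using assoc_mult_mat[OF WT A W(1)] by simp
    also have "\<dots> = col W i \<bullet> (A *\<^sub>v v)"
      using that W A by (subst index_mult_mat) (auto simp: col_mult2[OF A W(1)] mult_mat_vec_def)
    also have "\<dots> = e * (col W i \<bullet> col W 0)"
      using v W that by (simp add: scalar_prod_smult_distrib[of _ "Suc m"])
    also have "col W i \<bullet> col W 0 = (transpose_mat W * W) $$ (i, 0)" using W(1) that by simp
    finally show ?thesis using W(2) that by simp
  qed
  have B0': "B $$ (0, i) = (if i = 0 then e else 0)" if "i < Suc m" for i
    using B0[OF that] that B by (subst symB[symmetric]) simp
  define C where "C = mat m m (\<lambda>(i, j). B $$ (Suc i, Suc j))"
  define E where "E = mat 1 1 (\<lambda>_. e)"
  have C: "C \<in> carrier_mat m m" and E: "E \<in> carrier_mat 1 1" by (auto simp: C_def E_def)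
  have "B $$ (i, j) = B $$ (j, i)" if "i < Suc m" "j < Suc m" for i j
    using that B by (subst symB[symmetric]) simp
  then have "transpose_mat C = C" by (intro eq_matI) (auto simp: C_def)
  from Suc.IH[OF C this] obtain Q f where Q: "Q \<in> carrier_mat m m"
    "transpose_mat Q * Q = 1\<^sub>m m" "transpose_mat Q * C * Q = mat_diag m f" by blast
  define U where "U = four_block_mat (1\<^sub>m 1) (0\<^sub>m 1 m) (0\<^sub>m m 1) Q"
  have U: "U \<in> carrier_mat (Suc m) (Suc m)" using Q by (auto simp: U_def)
  have UT: "transpose_mat U = four_block_mat (1\<^sub>m 1) (0\<^sub>m 1 m) (0\<^sub>m m 1) (transpose_mat Q)"
    unfolding U_def using Q by (subst transpose_four_block_mat) auto
  have Bblock: "B = four_block_mat E (0\<^sub>m 1 m) (0\<^sub>m m 1) C"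
    using B B0 B0' by (intro eq_matI) (auto simp: E_def C_def)
  have QT: "transpose_mat Q \<in> carrier_mat m m" using Q by simp
  have "transpose_mat U * B = four_block_mat E (0\<^sub>m 1 m) (0\<^sub>m m 1) (transpose_mat Q * C)"
    unfolding UT Bblock using Q C E QT
    by (subst mult_four_block_mat[of _ 1 1 _ m _ m _ _ 1 _ m]) auto
  then have UBU: "transpose_mat U * B * U =
      four_block_mat E (0\<^sub>m 1 m) (0\<^sub>m m 1) (transpose_mat Q * C * Q)"
    unfolding U_def using Q C E QT
    by (simp, subst mult_four_block_mat[of _ 1 1 _ m _ m _ _ 1 _ m]) auto
  have UU: "transpose_mat U * U = 1\<^sub>m (Suc m)"
    unfolding UT unfolding U_def using Q QT
    by (subst mult_four_block_mat[of _ 1 1 _ m _ m _ _ 1 _ m]) auto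
  define P where "P = W * U"
  have P: "P \<in> carrier_mat (Suc m) (Suc m)" using W U by (simp add: P_def)
  have UTc: "transpose_mat U \<in> carrier_mat (Suc m) (Suc m)" using U by simp
  have PT: "transpose_mat P = transpose_mat U * transpose_mat W"
    unfolding P_def by (rule transpose_mult[OF W(1) U])
  have "transpose_mat P * P = transpose_mat U * (transpose_mat W * W) * U"
    unfolding PT unfolding P_def using UTc WT W(1) U
    by (simp add: assoc_mult_mat[of _ "Suc m" "Suc m" _ "Suc m" _ "Suc m"])
  then have PP: "transpose_mat P * P = 1\<^sub>m (Suc m)" using W(2) UTc UU by simp
  have "transpose_mat P * A * P = transpose_mat U * B * U"
    unfolding PT B_def unfolding P_def using UTc WT W(1) U A
    by (simp add: assoc_mult_mat[of _ "Suc m" "Suc m" _ "Suc m" _ "Suc m"])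
  also have "\<dots> = mat_diag (Suc m) (case_nat e f)"
    unfolding UBU Q(3) by (intro eq_matI) (auto simp: mat_diag_def E_def split: nat.split)
  finally show ?case using P PP by blast
qed

section \<open>Eigenvalue counts and eigenvectors inside a plane\<close>

lemma proots_prod_linear_factors:
  "proots (\<Prod>a\<leftarrow>as. [:- a, 1:]) = mset (as :: 'a :: idom list)"
proof (induction as)
  case (Cons a as)
  have "(\<Prod>a\<leftarrow>as. [:- a, 1:]) \<noteq> 0" by (auto simp: prod_list_zero_iff)
  with Cons show ?case by (simp add: proots_mult del: mult_pCons_left)
qed simp

lemma proots_char_poly_of_diagonalization:
  fixes A :: "real mat"
  assumes A: "A \<in> carrier_mat n n" and P: "P \<in> carrier_mat n n" "transpose_mat P * P = 1\<^sub>m n"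
    and diag: "transpose_mat P * A * P = mat_diag n f"
  shows "proots (char_poly A) = mset (map f [0..<n])"
proof -
  have PP: "P * transpose_mat P = 1\<^sub>m n"
    using mat_mult_left_right_inverse[OF _ P(1) P(2)] P by simp
  have "similar_mat_wit (mat_diag n f) A (transpose_mat P) P"
    using A P PP diag by (intro similar_mat_witI[of _ _ n]) auto
  then have "char_poly A = char_poly (mat_diag n f)"
    using char_poly_similar[of "mat_diag n f" A] unfolding similar_mat_def by metis
  also have "\<dots> = (\<Prod>a\<leftarrow>diag_mat (mat_diag n f). [:- a, 1:])"
    by (rule char_poly_upper_triangular[of _ n]) (auto simp: mat_diag_def)
  also have "diag_mat (mat_diag n f) = map f [0..<n]"
    by (auto simp: diag_mat_def mat_diag_def)
  finally show ?thesis using proots_prod_linear_factors[of "map f [0..<n]"] by simp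
qed

text \<open>The list is ascending, so its last entry but one is the second largest element and
  bounds everything except the last entry.\<close>

lemma few_above_second_largest:
  assumes "size M \<ge> 2" "rev (sorted_list_of_multiset M) ! 1 \<le> (\<theta> :: real)"
  shows "size (filter_mset (\<lambda>x. x > \<theta>) M) \<le> 1"
proof -
  define l where "l = sorted_list_of_multiset M"
  have l: "sorted l" "mset l = M" by (auto simp: l_def)
  then have len: "length l \<ge> 2" using assms by (metis size_mset)
  have "l ! (length l - 2) \<le> \<theta>"
    using assms len by (simp add: l_def[symmetric] rev_nth numeral_2_eq_2)
  have "x \<le> \<theta>" if "x \<in> set (butlast l)" for x
  proof -
    obtain i where i: "i < length l - 1" "x = l ! i"
      using \<open>x \<in> set (butlast l)\<close> by (auto simp: in_set_conv_nth nth_butlast)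
    have "l ! i \<le> l ! (length l - 2)" using i len by (intro sorted_nth_mono[OF l(1)]) auto
    then show ?thesis using i \<open>l ! (length l - 2) \<le> \<theta>\<close> by simp
  qed
  then have "filter (\<lambda>x. x > \<theta>) (butlast l) = []"
    by (fastforce simp: filter_empty_conv)
  moreover have "l = butlast l @ [last l]" using len by (cases l rule: rev_cases) auto
  ultimately have "length (filter (\<lambda>x. x > \<theta>) l) \<le> 1"
    by (metis (no_types, lifting) append_Nil filter_append length_filter_le length_Cons list.size(3) One_nat_def)
  then show ?thesis using l by (metis mset_filter size_mset)
qed

lemma few_below_second_smallest:
  assumes "size M \<ge> 2" "rev (sorted_list_of_multiset M) ! (size M - 2) \<ge> (\<theta> :: real)"
  shows "size (filter_mset (\<lambda>x. x < \<theta>) M) \<le> 1"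
proof -
  define l where "l = sorted_list_of_multiset M"
  have l: "sorted l" "mset l = M" by (auto simp: l_def)
  have size: "size M = length l" using l by (metis size_mset)
  obtain x y r where xy: "l = x # y # r" using assms size by (cases l; cases "tl l") auto
  have "y \<ge> \<theta>"
    using assms size by (simp add: l_def[symmetric] size rev_nth) (simp add: xy)
  then have "filter (\<lambda>x. x < \<theta>) (y # r) = []" using l(1) xy by (fastforce simp: filter_empty_conv)
  then have "length (filter (\<lambda>x. x < \<theta>) l) \<le> 1" using xy by auto
  then show ?thesis using l by (metis mset_filter size_mset)
qed

text \<open>In the coordinates \<open>c = ?T *\<^sub>v z\<close> the form of \<open>A\<close> minus
  \<open>\<theta>\<close> times the squared norm is a diagonal sum with at most one positive
  coefficient. Some nontrivial combination of \<open>x\<close> and \<open>y\<close> has coordinate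
  zero there, so its sum is at most 0; by \<open>ge\<close> it is at least 0. Hence every term
  vanishes and \<open>c\<close> lives only where \<open>f i = \<theta>\<close>.\<close>

lemma eigenvector_in_plane_of_diagonalization:
  fixes A :: "real mat"
  assumes A: "A \<in> carrier_mat n n" and P: "P \<in> carrier_mat n n" "transpose_mat P * P = 1\<^sub>m n"
    and diag: "transpose_mat P * A * P = mat_diag n f"
    and few: "card {i. i < n \<and> f i > \<theta>} \<le> 1"
    and xy: "x \<in> carrier_vec n" "y \<in> carrier_vec n"
    and ge: "\<And>p q z. z = p \<cdot>\<^sub>v x + q \<cdot>\<^sub>v y \<Longrightarrow> \<theta> * (z \<bullet> z) \<le> z \<bullet> (A *\<^sub>v z)"
  obtains p q where "(p, q) \<noteq> (0, 0)"
    "A *\<^sub>v (p \<cdot>\<^sub>v x + q \<cdot>\<^sub>v y) = \<theta> \<cdot>\<^sub>v (p \<cdot>\<^sub>v x + q \<cdot>\<^sub>v y)"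
proof -
  let ?T = "transpose_mat P"
  have T: "?T \<in> carrier_mat n n" using P by simp
  have PP: "P * ?T = 1\<^sub>m n"
    using mat_mult_left_right_inverse[OF T P(1) P(2)] .
  have "finite {i. i < n \<and> f i > \<theta>}" by simp
  \<comment> \<open>If no entry exceeds \<open>\<theta>\<close>, then \<open>k\<close> is arbitrary,
    possibly out of range, and \<open>a\<close>, \<open>b\<close> are unspecified numbers. This is
    harmless: \<open>k\<close> is consulted only at an index \<open>i < n\<close> with
    \<open>f i > \<theta>\<close>.\<close>
  then obtain k where k: "\<And>i. i < n \<Longrightarrow> f i > \<theta> \<Longrightarrow> i = k"
    using few by (metis (mono_tags, lifting) card_le_Suc0_iff_eq One_nat_def mem_Collect_eq)
  define a b where "a = (?T *\<^sub>v x) $ k" and "b = (?T *\<^sub>v y) $ k"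
  obtain p q where pq: "(p, q) \<noteq> (0, 0)" "p * a + q * b = 0"
  proof (cases "a = 0 \<and> b = 0")
    case True then show thesis using that[of 1 0] by simp
  next
    case False then show thesis using that[of b "-a"] by auto
  qed
  define z where "z = p \<cdot>\<^sub>v x + q \<cdot>\<^sub>v y"
  have z: "z \<in> carrier_vec n" using xy by (simp add: z_def)
  define c where "c = ?T *\<^sub>v z"
  have c: "c \<in> carrier_vec n" using T z by (simp add: c_def)
  have Pc: "P *\<^sub>v c = z" unfolding c_def using PP z T P
    by (simp add: assoc_mult_mat_vec[symmetric, of _ n n _ n])
  have Dc: "mat_diag n f *\<^sub>v c = vec n (\<lambda>i. f i * c $ i)"
  proof (rule eq_vecI)
    fix i assume "i < dim_vec (vec n (\<lambda>i. f i * c $ i))"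
    then have i: "i < n" by simp
    have "(mat_diag n f *\<^sub>v c) $ i = (\<Sum>j\<in>{0..<n}. if i = j then f j * c $ j else 0)"
      using i c by (auto simp: mat_diag_def scalar_prod_def if_distrib[of "\<lambda>x. x * _"] cong: if_cong
          intro!: sum.cong)
    also have "\<dots> = f i * c $ i" using i by (subst sum.delta') auto
    finally show "(mat_diag n f *\<^sub>v c) $ i = vec n (\<lambda>i. f i * c $ i) $ i" using i by simp
  qed (auto simp: mat_diag_def)
  have "A * P = P * (?T * A * P)"
    proof -
    have "P * (?T * A * P) = P * ?T * (A * P)"
      using P T A by (simp add: assoc_mult_mat[of _ n n _ n _ n])
    also have "\<dots> = A * P" using PP A P by simp
    finally show ?thesis ..
  qed
  then have AP: "A * P = P * mat_diag n f" using diag by simp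
  have Az: "A *\<^sub>v z = P *\<^sub>v (mat_diag n f *\<^sub>v c)"
    unfolding Pc[symmetric]
    using arg_cong[OF AP, of "\<lambda>M. M *\<^sub>v c"] A P c
    by (simp add: assoc_mult_mat_vec[of _ n n _ n])
  have "z \<bullet> (A *\<^sub>v z) = c \<bullet> (mat_diag n f *\<^sub>v c)"
    unfolding Az unfolding c_def
    by (rule transpose_vec_mult_scalar[OF P(1) _ z, symmetric])
      (use T z in \<open>auto intro!: mult_mat_vec_carrier[of _ n n]\<close>)
  also have "\<dots> = (\<Sum>i<n. f i * (c $ i)\<^sup>2)"
    unfolding Dc by (simp add: scalar_prod_def power2_eq_square atLeast0LessThan algebra_simps)
  finally have zAz: "z \<bullet> (A *\<^sub>v z) = (\<Sum>i<n. f i * (c $ i)\<^sup>2)" .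
  have "z \<bullet> z = z \<bullet> (P *\<^sub>v c)" using Pc by simp
  also have "\<dots> = c \<bullet> c" unfolding c_def
    using P z T c by (subst transpose_vec_mult_scalar[of P n n, symmetric]) (auto simp: c_def)
  also have "\<dots> = (\<Sum>i<n. (c $ i)\<^sup>2)"
    using c by (simp add: scalar_prod_def power2_eq_square atLeast0LessThan)
  finally have zz: "z \<bullet> z = (\<Sum>i<n. (c $ i)\<^sup>2)" .
  have terms: "(f i - \<theta>) * (c $ i)\<^sup>2 \<le> 0" if "i < n" for i
  proof (cases "f i > \<theta>")
    case True
    then have "i = k" using k that by simp
    then have "c $ i = p * a + q * b"
      unfolding c_def z_def a_def b_def using that P T xy
      by (simp add: mult_add_distrib_mat_vec[of _ n n] mult_mat_vec[of _ n n])
    then show ?thesis using pq by simp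
  qed (auto intro: mult_nonpos_nonneg)
  have "\<theta> * (z \<bullet> z) \<le> z \<bullet> (A *\<^sub>v z)" by (rule ge[OF z_def])
  \<comment> \<open>The sum is nonnegative while each of its terms is at most 0 by
    \<open>terms\<close>, so all terms are zero.\<close>
  then have "0 \<le> (\<Sum>i<n. (f i - \<theta>) * (c $ i)\<^sup>2)"
    unfolding zAz zz by (simp add: sum_distrib_left algebra_simps sum_subtractf)
  then have "(\<Sum>i<n. - ((f i - \<theta>) * (c $ i)\<^sup>2)) \<le> 0" by (simp add: sum_negf)
  then have "(\<Sum>i<n. - ((f i - \<theta>) * (c $ i)\<^sup>2)) = 0"
    using terms by (intro antisym sum_nonneg) auto
  then have "\<forall>i\<in>{..<n}. - ((f i - \<theta>) * (c $ i)\<^sup>2) = 0"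
    using terms by (subst (asm) sum_nonneg_eq_0_iff) auto
  then have "f i * c $ i = \<theta> * c $ i" if "i < n" for i using that by auto
  then have "mat_diag n f *\<^sub>v c = \<theta> \<cdot>\<^sub>v c" unfolding Dc using c by (intro eq_vecI) auto
  then have "A *\<^sub>v z = \<theta> \<cdot>\<^sub>v z" using Az Pc P c by (simp add: mult_mat_vec)
  with pq(1) show thesis by (intro that[of p q]) (auto simp: z_def)
qed

lemma size_filter_mset_upt:
  "size (filter_mset Q (mset (map f [0..<n]))) = card {i. i < n \<and> Q (f i)}"
proof -
  have "size (filter_mset Q (mset (map f [0..<n]))) = length (filter Q (map f [0..<n]))"
    by (metis mset_filter size_mset)
  also have "\<dots> = length (filter (Q \<circ> f) [0..<n])" by (simp only: filter_map length_map)
  also have "\<dots> = card (set (filter (Q \<circ> f) [0..<n]))" by (rule distinct_card[symmetric]) simp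
  also have "set (filter (Q \<circ> f) [0..<n]) = {i. i < n \<and> Q (f i)}" by auto
  finally show ?thesis .
qed

lemma eigenvector_in_plane_above:
  fixes A :: "real mat"
  assumes A: "A \<in> carrier_mat n n" "transpose_mat A = A" and n: "n \<ge> 2"
    and le: "nth_largest_eigenvalue A 2 \<le> \<theta>"
    and xy: "x \<in> carrier_vec n" "y \<in> carrier_vec n"
    and ge: "\<And>p q z. z = p \<cdot>\<^sub>v x + q \<cdot>\<^sub>v y \<Longrightarrow> \<theta> * (z \<bullet> z) \<le> z \<bullet> (A *\<^sub>v z)"
  obtains p q where "(p, q) \<noteq> (0, 0)"
    "A *\<^sub>v (p \<cdot>\<^sub>v x + q \<cdot>\<^sub>v y) = \<theta> \<cdot>\<^sub>v (p \<cdot>\<^sub>v x + q \<cdot>\<^sub>v y)"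
proof -
  obtain P f where P: "P \<in> carrier_mat n n" "transpose_mat P * P = 1\<^sub>m n"
    "transpose_mat P * A * P = mat_diag n f"
    using orthogonal_diagonalization[OF A] by blast
  note M = proots_char_poly_of_diagonalization[OF A(1) P]
  have "size (filter_mset (\<lambda>x. x > \<theta>) (proots (char_poly A))) \<le> 1"
    using le by (intro few_above_second_largest) (simp_all add: M n nth_largest_eigenvalue_def)
  then have "card {i. i < n \<and> f i > \<theta>} \<le> 1" by (simp only: M size_filter_mset_upt)
  then show thesis by (rule eigenvector_in_plane_of_diagonalization[OF A(1) P _ xy ge that])
qed

text \<open>Mirror image of the previous lemma, obtained by passing to \<open>- A\<close> and
  \<open>- \<theta>\<close>. Of \<open>n\<close> eigenvalues the one of index \<open>n - 1\<close>
  is the second smallest.\<close>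

lemma eigenvector_in_plane_below:
  fixes A :: "real mat"
  assumes A: "A \<in> carrier_mat n n" "transpose_mat A = A" and n: "n \<ge> 2"
    and ge: "nth_largest_eigenvalue A (n - 1) \<ge> \<theta>"
    and xy: "x \<in> carrier_vec n" "y \<in> carrier_vec n"
    and le: "\<And>p q z. z = p \<cdot>\<^sub>v x + q \<cdot>\<^sub>v y \<Longrightarrow> z \<bullet> (A *\<^sub>v z) \<le> \<theta> * (z \<bullet> z)"
  obtains p q where "(p, q) \<noteq> (0, 0)"
    "A *\<^sub>v (p \<cdot>\<^sub>v x + q \<cdot>\<^sub>v y) = \<theta> \<cdot>\<^sub>v (p \<cdot>\<^sub>v x + q \<cdot>\<^sub>v y)"
proof -
  obtain P f where P: "P \<in> carrier_mat n n" "transpose_mat P * P = 1\<^sub>m n"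
    "transpose_mat P * A * P = mat_diag n f"
    using orthogonal_diagonalization[OF A] by blast
  note M = proots_char_poly_of_diagonalization[OF A(1) P]
  have "size (filter_mset (\<lambda>x. x < \<theta>) (proots (char_poly A))) \<le> 1"
    using ge n by (intro few_below_second_smallest)
      (simp_all add: M nth_largest_eigenvalue_def numeral_2_eq_2)
  then have "card {i. i < n \<and> f i < \<theta>} \<le> 1" by (simp only: M size_filter_mset_upt)
  then have few: "card {i. i < n \<and> - f i > - \<theta>} \<le> 1" by simp
  have A': "- A \<in> carrier_mat n n" using A by simp
  have "transpose_mat P * (- A) * P = - (transpose_mat P * A * P)"
    using P A by simp
  also have "\<dots> = mat_diag n (\<lambda>i. - f i)" unfolding P(3) by (auto simp: mat_diag_def)
  finally have diag: "transpose_mat P * (- A) * P = mat_diag n (\<lambda>i. - f i)" .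
  have neg: "(- A) *\<^sub>v z = - (A *\<^sub>v z)" if "z \<in> carrier_vec n" for z
    using A that by (intro Matrix.eq_vecI) (auto simp: uminus_mult_mat_vec)
  obtain p q where pq: "(p, q) \<noteq> (0, 0)"
    "(- A) *\<^sub>v (p \<cdot>\<^sub>v x + q \<cdot>\<^sub>v y) = - \<theta> \<cdot>\<^sub>v (p \<cdot>\<^sub>v x + q \<cdot>\<^sub>v y)"
  proof (rule eigenvector_in_plane_of_diagonalization[OF A' P(1,2) diag few xy])
    fix p q z assume z: "z = p \<cdot>\<^sub>v x + q \<cdot>\<^sub>v y"
    then have zc: "z \<in> carrier_vec n" using xy by simp
    have "z \<bullet> (- A *\<^sub>v z) = - (z \<bullet> (A *\<^sub>v z))"
      unfolding neg[OF zc] using zc A by (subst scalar_prod_uminus_right) auto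
    then show "- \<theta> * (z \<bullet> z) \<le> z \<bullet> (- A *\<^sub>v z)" using le[OF z] by simp
  qed blast
  define z where "z = p \<cdot>\<^sub>v x + q \<cdot>\<^sub>v y"
  have z: "z \<in> carrier_vec n" using xy by (simp add: z_def)
  have "- (A *\<^sub>v z) = - \<theta> \<cdot>\<^sub>v z" using pq(2) neg[OF z] by (simp add: z_def)
  then have "A *\<^sub>v z = - (- \<theta> \<cdot>\<^sub>v z)" by (metis uminus_uminus_vec)
  also have "\<dots> = \<theta> \<cdot>\<^sub>v z" by (intro Matrix.eq_vecI) auto
  finally show thesis using pq(1) that unfolding z_def by blast
qed

section \<open>Non-backtracking walks and girth\<close>

text \<open>Only immediate reversals are forbidden, so extensions of a walk are easy to count. That
  short walks repeat no vertex at all is deduced from the girth later.\<close>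

fun nb_walk :: "'a rel \<Rightarrow> 'a list \<Rightarrow> bool" where
  "nb_walk E (x # y # z # zs) \<longleftrightarrow> (x, y) \<in> E \<and> x \<noteq> z \<and> nb_walk E (y # z # zs)"
| "nb_walk E [x, y] \<longleftrightarrow> (x, y) \<in> E"
| "nb_walk E [x] \<longleftrightarrow> True"
| "nb_walk E [] \<longleftrightarrow> True"

lemma nb_walk_ConsD: "nb_walk E (x # xs) \<Longrightarrow> nb_walk E xs"
  by (cases xs; cases "tl xs") auto

lemma nb_walk_ConsConsD: "nb_walk E (x # y # xs) \<Longrightarrow> (x, y) \<in> E"
  by (cases xs) auto

text \<open>The pieces overlap in two vertices because the condition concerns three consecutive
  vertices: each such window then lies within one of the pieces.\<close>

lemma nb_walk_append:
  "nb_walk E (xs @ y # z # zs) \<longleftrightarrow> nb_walk E (xs @ [y, z]) \<and> nb_walk E (y # z # zs)"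
proof (induction xs)
  case Nil
  then show ?case by (cases zs) auto
next
  case (Cons x xs)
  then show ?case
    by (cases xs; cases "tl xs") auto
qed

lemma nb_walk_appendD:
  "nb_walk E (xs @ ys) \<Longrightarrow> nb_walk E xs"
  "nb_walk E (xs @ ys) \<Longrightarrow> nb_walk E ys"
proof -
  show "nb_walk E (xs @ ys) \<Longrightarrow> nb_walk E ys"
    by (induction xs) (auto dest: nb_walk_ConsD)
  show "nb_walk E (xs @ ys) \<Longrightarrow> nb_walk E xs"
    by (induction E xs rule: nb_walk.induct; cases ys) auto
qed

lemma nb_walk_rev:
  assumes "sym E" "nb_walk E xs"
  shows "nb_walk E (rev xs)"
  using assms
proof (induction E xs rule: nb_walk.induct)
  case (1 E x y z zs)
  then show ?case
    using nb_walk_append[of E "rev zs" z y "[x]"] 1 by (auto dest: symD nb_walk_ConsConsD)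
qed (auto dest: symD)

text \<open>Where two such walks first part, reversing the rest of one and continuing with the rest
  of the other gives a non-backtracking walk that visits the common end vertex twice, yet is short
  enough to be distinct.\<close>

lemma nb_walk_unique:
  assumes "sym E" and short: "\<And>xs. nb_walk E xs \<Longrightarrow> length xs \<le> g \<Longrightarrow> distinct xs"
    and "nb_walk E p" "nb_walk E q" "p \<noteq> []" "q \<noteq> []" "hd p = hd q" "last p = last q"
    and "length p + length q \<le> Suc g"
  shows "p = q"
proof -
  \<comment> \<open>With the shared first vertex \<open>u\<close> split off, the joined walk has
    \<open>length p + length q + 1\<close> vertices, which is at most \<open>g\<close>.\<close>
  have "p = q" if "nb_walk E (u # p)" "nb_walk E (u # q)" "last (u # p) = last (u # q)"
    "length p + length q < g" for u p q
    using that
  proof (induction p arbitrary: u q)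
    case Nil
    then have "distinct (u # q)" by (intro short) auto
    with Nil(3) show ?case by (metis distinct.simps(2) last_ConsL last_ConsR last_in_set)
  next
    case (Cons a p)
    show ?case
    proof (cases q)
      case Nil
      have "distinct (u # a # p)" using Cons Nil by (intro short) auto
      with Cons(4) Nil show ?thesis by (metis distinct.simps(2) last_ConsL last_ConsR last_in_set)
    next
      case (Cons b q')
      show ?thesis
      proof (cases "a = b")
        case True
        then show ?thesis
          using Cons.IH[of a q'] Cons.prems \<open>q = b # q'\<close> by (auto dest: nb_walk_ConsD)
      next
        case False
        \<comment> \<open>The turn at \<open>u\<close> comes from \<open>a\<close> and goes to
          \<open>b\<close>, so \<open>a \<noteq> b\<close> is exactly what makes the joined walk
          non-backtracking.\<close>
        have "nb_walk E (rev p @ [a, u])"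
          using nb_walk_rev[OF assms(1) Cons.prems(1)] by simp
        moreover have "nb_walk E (a # u # b # q')"
          using Cons.prems False \<open>q = b # q'\<close> \<open>nb_walk E (rev p @ [a, u])\<close>
          by (auto dest: nb_walk_appendD(2))
        ultimately have "nb_walk E (rev p @ a # u # b # q')"
          using nb_walk_append by metis
        then have "distinct (rev p @ a # u # b # q')"
          using Cons.prems \<open>q = b # q'\<close> by (intro short) auto
        then have "set (a # p) \<inter> set (b # q') = {}" by auto
        moreover have "last (a # p) = last (b # q')"
          using Cons.prems \<open>q = b # q'\<close> by simp
        ultimately show ?thesis by (metis disjoint_iff last_in_set list.distinct(1))
      qed
    qed
  qed
  note unique = this
  obtain u p' where p: "p = u # p'" using assms(5) by (cases p) auto
  obtain q' where q: "q = u # q'" using assms(6,7) p by (cases q) auto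
  show ?thesis
    using unique[OF assms(3,4)[unfolded p q] assms(8)[unfolded p q]] assms(9) by (simp add: p q)
qed

section \<open>Girth and short non-backtracking walks in a graph\<close>

context pair_graph
begin

lemma sym_parcs: "sym (parcs G)"
  by (auto intro: symI arcs_symmetric)

lemma out_degree_eq_card: "out_degree (with_proj G) v = card (parcs G `` {v})"
proof -
  have "out_arcs (with_proj G) v = Pair v ` (parcs G `` {v})"
    by (auto simp: out_arcs_def image_iff)
  then show ?thesis by (simp add: out_degree_def card_image inj_on_def)
qed

lemma nb_walk_vwalk_arcs:
  assumes "nb_walk (parcs G) xs" "xs \<noteq> []"
  shows "set (vwalk_arcs xs) \<subseteq> parcs G" "pcas (hd xs) (vwalk_arcs xs) (last xs)"
    "pawalk_verts (hd xs) (vwalk_arcs xs) = xs"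
proof -
  have "set (vwalk_arcs xs) \<subseteq> parcs G \<and> pcas (hd xs) (vwalk_arcs xs) (last xs) \<and>
    pawalk_verts (hd xs) (vwalk_arcs xs) = xs"
    using assms
  proof (induction xs rule: vwalk_arcs.induct)
    case (3 x y xs)
    then show ?case by (cases xs) (auto dest: nb_walk_ConsD)
  qed auto
  then show "set (vwalk_arcs xs) \<subseteq> parcs G" "pcas (hd xs) (vwalk_arcs xs) (last xs)"
    "pawalk_verts (hd xs) (vwalk_arcs xs) = xs" by auto
qed

text \<open>Induction reduces to a walk whose tail is distinct, so that its head \<open>x\<close> is
  the only repeated vertex. The segment up to the second occurrence of \<open>x\<close> is the
  cycle; it has one arc fewer than vertices, hence the strict length bound.\<close>

lemma nb_walk_contains_cycle:
  assumes "nb_walk (parcs G) xs" "\<not> distinct xs"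
  shows "\<exists>p. cycle p \<and> 3 \<le> length p \<and> length p < length xs"
  using assms
proof (induction xs)
  case (Cons x xs)
  show ?case
  proof (cases "distinct xs")
    case False
    then show ?thesis using Cons by (force dest: nb_walk_ConsD)
  next
    case True
    then obtain bs cs where xs: "xs = bs @ x # cs" using Cons.prems by (auto dest: split_list)
    define c where "c = x # bs @ [x]"
    have nb: "nb_walk (parcs G) c"
      using Cons.prems(1) nb_walk_appendD(1)[of _ c cs] by (simp add: c_def xs)
    have "c \<noteq> []" "hd c = x" "last c = x" by (auto simp: c_def)
    note w = nb_walk_vwalk_arcs[OF nb \<open>c \<noteq> []\<close>, unfolded \<open>hd c = x\<close> \<open>last c = x\<close>]
    have len: "length (vwalk_arcs c) = Suc (length bs)"
      using vwalk_length_simp[of c, unfolded vwalk_length_def] by (simp add: c_def)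
    \<comment> \<open>With \<open>bs\<close> empty the segment would be a loop, and with one entry
      it would be an immediate reversal.\<close>
    have "length bs \<ge> 2"
    proof (rule ccontr)
      assume "\<not> ?thesis"
      then consider "bs = []" | y where "bs = [y]" by (cases bs; cases "tl bs") auto
      then show False using nb by cases (auto simp: c_def dest: no_loops')
    qed
    moreover have "cycle (vwalk_arcs c)"
    proof -
      have "x \<in> pverts G" using nb \<open>length bs \<ge> 2\<close>
        by (cases bs; cases "tl bs") (auto simp: c_def dest: in_arcsD1)
      moreover have "distinct (tl c)" using True by (auto simp: c_def xs)
      moreover have "vwalk_arcs c \<noteq> []" using len by auto
      ultimately show ?thesis using w unfolding cycle_def awalk_def by auto
    qed
    ultimately show ?thesis using len by (auto simp: xs)
  qed
qed simp

text \<open>A cycle found in the walk would have fewer arcs than the walk has vertices, so it would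
  be shorter than the girth.\<close>

lemma distinct_short_nb_walk:
  assumes "nb_walk (parcs G) xs" "length xs \<le> girth G"
  shows "distinct xs"
proof (rule ccontr)
  assume "\<not> distinct xs"
  then obtain p where "cycle p" "3 \<le> length p" "length p < length xs"
    using nb_walk_contains_cycle[OF assms(1)] by blast
  moreover from this have "girth G \<le> length p"
    unfolding girth_def by (intro cInf_lower) auto
  ultimately show False using assms(2) by simp
qed

lemma min_degree_le:
  assumes "v \<in> pverts G"
  shows "min_degree G \<le> card (parcs G `` {v})"
  unfolding min_degree_def out_degree_eq_card[symmetric]
  using assms by (intro Min_le) (auto simp: pair_finite_verts)

lemma finite_nbrs [simp]: "finite (parcs G `` {v})"
  by (rule finite_subset[OF _ pair_finite_verts]) (auto dest: in_arcsD2)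

text \<open>Since \<open>Inf {} = 0\<close>, a cycle has to be exhibited. With minimum degree 2 a
  non-backtracking walk can always be prolonged; once it has more entries than there are vertices,
  it repeats one.\<close>

lemma girth_ge_3:
  assumes "pverts G \<noteq> {}" "min_degree G \<ge> 2"
  shows "girth G \<ge> 3"
proof -
  have "\<exists>xs. length xs = Suc m \<and> set xs \<subseteq> pverts G \<and> nb_walk (parcs G) xs" for m
  proof (induction m)
    case 0
    from assms obtain v where "v \<in> pverts G" by auto
    then show ?case by (intro exI[of _ "[v]"]) auto
  next
    case (Suc m)
    then obtain y ys where ys: "length (y # ys) = Suc m" "set (y # ys) \<subseteq> pverts G"
      "nb_walk (parcs G) (y # ys)" by (metis length_Suc_conv)
    have "\<exists>x. (y, x) \<in> parcs G \<and> (ys \<noteq> [] \<longrightarrow> x \<noteq> hd ys)"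
    proof (rule ccontr)
      assume "\<not> ?thesis"
      then have "parcs G `` {y} \<subseteq> {hd ys}" by auto
      then have "card (parcs G `` {y}) \<le> 1" using card_mono[of "{hd ys}"] by force
      then show False using min_degree_le[of y] ys assms by simp
    qed
    then obtain x where x: "(y, x) \<in> parcs G" "ys \<noteq> [] \<Longrightarrow> x \<noteq> hd ys" by blast
    then have "nb_walk (parcs G) (x # y # ys)"
      using ys by (cases ys) (auto intro: arcs_symmetric)
    moreover have "x \<in> pverts G" using x by (auto dest: in_arcsD2)
    ultimately show ?case using ys by (intro exI[of _ "x # y # ys"]) auto
  qed
  then obtain xs where xs: "length xs = Suc (card (pverts G))" "set xs \<subseteq> pverts G"
    "nb_walk (parcs G) xs" by blast
  have "\<not> distinct xs"
    using xs distinct_card[of xs] card_mono[OF pair_finite_verts xs(2)] by auto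
  then obtain p where "cycle p" "3 \<le> length p" using nb_walk_contains_cycle[OF xs(3)] by blast
  then have "{length p |p. cycle p \<and> 3 \<le> length p} \<noteq> {}" by auto
  from Inf_nat_def1[OF this] show ?thesis by (auto simp: girth_def)
qed

end

section \<open>Sides of small edge cuts\<close>

text \<open>Here \<open>a i\<close> will count the walks at level \<open>i\<close> of a tree grown
  inside a side, and \<open>c i\<close> the arcs by which they could have left it. The root has one
  child more than other vertices have, and this surplus pays for all losses.\<close>

lemma odd_growth_sum:
  fixes a c :: "nat \<Rightarrow> nat"
  assumes "d \<ge> 1" "a 0 \<ge> Suc d"
    and step: "\<And>i. i < m \<Longrightarrow> d * a i \<le> a (Suc i) + c i"
    and c: "(\<Sum>i<m. c i) \<le> d"
  shows "Suc d + (\<Sum>i=2..Suc m. d ^ i) \<le> (\<Sum>i\<le>m. a i)"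
proof -
  \<comment> \<open>The surplus \<open>d\<close> stems from \<open>d * a 0 \<ge> d ^ 2 + d\<close>,
    so the invariant starts at level 1. What remains of it, \<open>d\<close> minus the losses so
    far, is nonnegative and does not shrink under multiplication by
    \<open>d \<ge> 1\<close>.\<close>
  have strong: "d ^ Suc i + d \<le> a i + (\<Sum>j<i. c j)" if "i \<le> m" "i \<ge> 1" for i
    using that
  proof (induction i)
    case (Suc i)
    have "(\<Sum>j<i. c j) \<le> d" using c sum_mono2[of "{..<m}" "{..<i}" c] Suc.prems by auto
    have "d ^ Suc (Suc i) + d \<le> d * a i + (\<Sum>j<i. c j)"
    proof (cases "i = 0")
      case True
      then show ?thesis using mult_le_mono2[OF assms(2), of d] by simp
    next
      case False
      then have "d ^ Suc i + (d - (\<Sum>j<i. c j)) \<le> a i"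
        using Suc \<open>(\<Sum>j<i. c j) \<le> d\<close> by simp
      from mult_le_mono2[OF this, of d]
      have "d ^ Suc (Suc i) + d * (d - (\<Sum>j<i. c j)) \<le> d * a i"
        by (simp add: distrib_left)
      moreover have "d - (\<Sum>j<i. c j) \<le> d * (d - (\<Sum>j<i. c j))" using assms(1) by simp
      ultimately show ?thesis using \<open>(\<Sum>j<i. c j) \<le> d\<close> by linarith
    qed
    then show ?case using step[of i] Suc.prems by simp
  qed simp
  have level: "d ^ Suc i \<le> a i" if "i \<le> m" "i \<ge> 1" for i
    using strong[OF that] c sum_mono2[of "{..<m}" "{..<i}" c] that by auto
  have "Suc d + (\<Sum>i=2..Suc k. d ^ i) \<le> (\<Sum>i\<le>k. a i)" if "k \<le> m" for k
    using that
  proof (induction k)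
    case 0
    then show ?case using assms(2) by simp
  next
    case (Suc k)
    have "(\<Sum>i=2..Suc (Suc k). d ^ i) = (\<Sum>i=2..Suc k. d ^ i) + d ^ Suc (Suc k)"
      by (simp add: sum.cl_ivl_Suc)
    then show ?case using Suc level[of "Suc k"] by simp
  qed
  then show ?thesis by simp
qed

text \<open>Two trees grow from the ends of an edge. Without losses level \<open>i\<close> would
  have \<open>2 * d ^ i\<close> walks; losses start at level 1 and cost level \<open>i\<close> at
  most \<open>d ^ (i - 1)\<close> of them. Summing these bounds over the levels telescopes.\<close>

lemma even_growth_sum:
  fixes a c :: "nat \<Rightarrow> nat"
  assumes "d \<ge> 1" "a 0 = 2" "c 0 = 0" "m \<ge> 1"
    and step: "\<And>i. i < m \<Longrightarrow> d * a i \<le> a (Suc i) + c i"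
    and c: "(\<Sum>i<m. c i) \<le> d"
  shows "2 + 2 * d ^ m + (\<Sum>i=1..m - 1. d ^ i) \<le> (\<Sum>i\<le>m. a i)"
proof -
  have a1: "2 * d \<le> a 1" using step[of 0] assms by simp
  \<comment> \<open>A loss at level \<open>j\<close> removes \<open>d ^ (i - j)\<close> walks from
    level \<open>Suc i\<close>, and \<open>c 0 = 0\<close> leaves only \<open>j \<ge> 1\<close>. For
    \<open>i = 0\<close> the truncated exponent \<open>i - 1\<close> is 0, but the sum it multiplies
    is \<open>c 0 = 0\<close>.\<close>
  have strong: "2 * d ^ Suc i \<le> a (Suc i) + d ^ (i - 1) * (\<Sum>j<Suc i. c j)" if "i < m" for i
    using that
  proof (induction i)
    case 0
    then show ?case using a1 assms by simp
  next
    case (Suc i)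
    have "d * (d ^ (i - 1) * (\<Sum>j<Suc i. c j)) = d ^ i * (\<Sum>j<Suc i. c j)"
      using assms(3) by (cases i) auto
    moreover have "d * (2 * d ^ Suc i) \<le> d * (a (Suc i) + d ^ (i - 1) * (\<Sum>j<Suc i. c j))"
      using Suc by (intro mult_le_mono2) simp
    ultimately have "2 * d ^ Suc (Suc i) \<le> d * a (Suc i) + d ^ i * (\<Sum>j<Suc i. c j)"
      by (simp add: distrib_left)
    moreover have "d * a (Suc i) \<le> a (Suc (Suc i)) + c (Suc i)" using step Suc.prems by simp
    moreover have "c (Suc i) \<le> d ^ i * c (Suc i)" 
      using mult_le_mono1[OF one_le_power[OF assms(1), of i], of "c (Suc i)"] by simp
    ultimately show ?case unfolding sum.lessThan_Suc[of c "Suc i"] diff_Suc_1 distrib_left by linarith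
  qed
  have level: "2 * d ^ Suc (Suc i) \<le> a (Suc (Suc i)) + d ^ Suc i" if "Suc i < m" for i
  proof -
    have "(\<Sum>j<Suc (Suc i). c j) \<le> d"
      using c sum_mono2[of "{..<m}" "{..<Suc (Suc i)}" c] that by auto
    then have "d ^ i * (\<Sum>j<Suc (Suc i). c j) \<le> d ^ i * d" by (rule mult_le_mono2)
    moreover have "d ^ i * d = d ^ Suc i" by simp
    ultimately show ?thesis using strong[OF that] unfolding diff_Suc_1 by linarith
  qed
  have "2 + 2 * d ^ Suc k + (\<Sum>i=1..k. d ^ i) \<le> (\<Sum>i\<le>Suc k. a i)" if "k < m" for k
    using that
  proof (induction k)
    case 0
    then show ?case using a1 assms by simp
  next
    case (Suc k)
    then show ?case using level[of k] by (simp del: power_Suc)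
  qed
  from this[of "m - 1"] show ?thesis using assms by simp
qed

text \<open>Walks are extended at the head, so \<open>hd\<close> is the end point away from the root.\<close>

definition nb_level :: "'a rel \<Rightarrow> 'a set \<Rightarrow> 'a list set \<Rightarrow> nat \<Rightarrow> 'a list set" where
  "nb_level E X R i = {q @ r |q r. r \<in> R \<and> length q = i \<and> set q \<subseteq> X \<and> nb_walk E (q @ r)}"

lemma nb_level_Suc:
  "nb_level E X R (Suc i) =
    (\<Union>p\<in>nb_level E X R i. (\<lambda>x. x # p) ` {x \<in> X. nb_walk E (x # p)})" (is "?l = ?r")
proof
  show "?l \<subseteq> ?r"
  proof
    fix w assume "w \<in> ?l"
    then obtain q r where w: "w = q @ r" "r \<in> R" "length q = Suc i" "set q \<subseteq> X"
      "nb_walk E (q @ r)" by (auto simp: nb_level_def)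
    then obtain x q' where q: "q = x # q'" by (cases q) auto
    have "q' @ r \<in> nb_level E X R i"
      using w q by (auto simp: nb_level_def dest: nb_walk_ConsD)
    then show "w \<in> ?r" using w q by force
  qed
  show "?r \<subseteq> ?l"
  proof
    fix w assume "w \<in> ?r"
    then obtain p x where w: "w = x # p" "p \<in> nb_level E X R i" "x \<in> X" "nb_walk E (x # p)"
      by auto
    then obtain q r where "p = q @ r" "r \<in> R" "length q = i" "set q \<subseteq> X"
      by (auto simp: nb_level_def)
    then show "w \<in> ?l" using w unfolding nb_level_def
      by (intro CollectI exI[of _ "x # q"] exI[of _ r]) auto
  qed
qed

lemma finite_nb_level: "finite X \<Longrightarrow> finite R \<Longrightarrow> finite (nb_level E X R i)"
proof (induction i)
  case 0
  have "nb_level E X R 0 \<subseteq> R" by (auto simp: nb_level_def)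
  then show ?case using 0 by (auto intro: finite_subset)
qed (auto simp: nb_level_Suc)

section \<open>Growing walks inside a side with few outgoing edges\<close>

context pair_graph
begin

definition outside_degree :: "'a set \<Rightarrow> 'a \<Rightarrow> nat" where
  "outside_degree X v = card (parcs G `` {v} - X)"

text \<open>The head of a walk has at least \<open>d + 1\<close> neighbours. One of them is the
  preceding vertex, which exists since roots have length at least 2; each other neighbour extends
  the walk inside \<open>X\<close> or lies outside \<open>X\<close>.\<close>

lemma nb_level_growth:
  assumes X: "X \<subseteq> pverts G" and R: "finite R" "\<And>r. r \<in> R \<Longrightarrow> length r \<ge> 2 \<and> hd r \<in> X"
    and deg: "min_degree G = Suc d"
  shows "d * card (nb_level (parcs G) X R i)
    \<le> card (nb_level (parcs G) X R (Suc i)) + (\<Sum>p\<in>nb_level (parcs G) X R i. outside_degree X (hd p))"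
proof -
  let ?L = "nb_level (parcs G) X R"
  have finX: "finite X" using X pair_finite_verts by (rule finite_subset)
  have fin: "finite (?L i)" using finX R(1) by (rule finite_nb_level)
  have "card (?L (Suc i)) = (\<Sum>p\<in>?L i. card ((\<lambda>x. x # p) ` {x \<in> X. nb_walk (parcs G) (x # p)}))"
    unfolding nb_level_Suc using fin finX by (intro card_UN_disjoint) auto
  also have "\<dots> = (\<Sum>p\<in>?L i. card {x \<in> X. nb_walk (parcs G) (x # p)})"
    by (intro sum.cong card_image) (auto simp: inj_on_def)
  finally have card: "card (?L (Suc i)) = (\<Sum>p\<in>?L i. card {x \<in> X. nb_walk (parcs G) (x # p)})" .
  have "d \<le> card {x \<in> X. nb_walk (parcs G) (x # p)} + outside_degree X (hd p)" if p: "p \<in> ?L i" for p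
  proof -
    obtain q r where qr: "p = q @ r" "r \<in> R" "set q \<subseteq> X" "nb_walk (parcs G) p"
      using p by (auto simp: nb_level_def)
    have "hd p \<in> X" using qr R(2)[OF qr(2)] by (cases q) auto
    moreover have "length p \<ge> 2" using qr R(2)[OF qr(2)] by simp
    then obtain y z zs where yz: "p = y # z # zs" by (cases p; cases "tl p") auto
    ultimately have "y \<in> pverts G" using X by auto
    have "parcs G `` {y} \<subseteq> insert z ({x \<in> X. nb_walk (parcs G) (x # p)} \<union> (parcs G `` {y} - X))"
      using qr(4) by (auto simp: yz intro: arcs_symmetric)
    then have "card (parcs G `` {y}) \<le> card (insert z ({x \<in> X. nb_walk (parcs G) (x # p)} \<union> (parcs G `` {y} - X)))"
      using finX by (intro card_mono) auto
    also have "\<dots> \<le> Suc (card ({x \<in> X. nb_walk (parcs G) (x # p)} \<union> (parcs G `` {y} - X)))"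
      by (rule card_insert_le_m1) auto
    also have "\<dots> \<le> Suc (card {x \<in> X. nb_walk (parcs G) (x # p)} + outside_degree X y)"
      unfolding outside_degree_def using card_Un_le by simp
    finally show ?thesis using min_degree_le[OF \<open>y \<in> pverts G\<close>] deg by (simp add: yz)
  qed
  then have "(\<Sum>p\<in>?L i. d) \<le>
      (\<Sum>p\<in>?L i. card {x \<in> X. nb_walk (parcs G) (x # p)} + outside_degree X (hd p))"
    by (rule sum_mono)
  then show ?thesis by (simp add: card sum.distrib mult.commute)
qed

text \<open>As heads identify walks across all levels, counting walks counts distinct vertices of
  \<open>Y\<close>, and the losses are charged to distinct vertices of \<open>X\<close>. The set
  \<open>Y\<close> allows a root vertex to be left out of the count.\<close>

lemma nb_levels_in_side:
  assumes X: "X \<subseteq> pverts G" and R: "finite R" "\<And>r. r \<in> R \<Longrightarrow> length r = 2 \<and> hd r \<in> X"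
    and inj: "inj_on hd (\<Union>i\<le>m. nb_level (parcs G) X R i)"
    and Y: "\<And>p. p \<in> (\<Union>i\<le>m. nb_level (parcs G) X R i) \<Longrightarrow> hd p \<in> Y" "Y \<subseteq> X"
  shows "(\<Sum>i\<le>m. card (nb_level (parcs G) X R i)) \<le> card Y"
    and "(\<Sum>i<m. \<Sum>p\<in>nb_level (parcs G) X R i. outside_degree X (hd p)) \<le> (\<Sum>x\<in>X. outside_degree X x)"
proof -
  let ?L = "nb_level (parcs G) X R"
  have finX: "finite X" using X pair_finite_verts by (rule finite_subset)
  then have finY: "finite Y" using Y(2) by (rule finite_subset[rotated])
  have fin: "finite (?L i)" for i using finX R(1) by (rule finite_nb_level)
  have len: "length p = i + 2" if "p \<in> ?L i" for p i using that R(2) by (auto simp: nb_level_def)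
  then have disj: "?L i \<inter> ?L j = {}" if "i \<noteq> j" for i j
    using that by (metis add_right_cancel disjoint_iff)
  have "(\<Sum>i\<le>m. card (?L i)) = card (\<Union>i\<le>m. ?L i)"
    using fin disj by (intro card_UN_disjoint[symmetric]) auto
  also have "\<dots> = card (hd ` (\<Union>i\<le>m. ?L i))" using inj by (rule card_image[symmetric])
  also have "\<dots> \<le> card Y" using finY Y(1) by (intro card_mono) auto
  finally show "(\<Sum>i\<le>m. card (?L i)) \<le> card Y" .
  have inj': "inj_on hd (\<Union>i<m. ?L i)" by (rule inj_on_subset[OF inj], rule UN_mono) auto
  have "(\<Sum>i<m. \<Sum>p\<in>?L i. outside_degree X (hd p)) = (\<Sum>p\<in>(\<Union>i<m. ?L i). outside_degree X (hd p))"
    using fin disj by (intro sum.UNION_disjoint[symmetric]) auto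
  also have "\<dots> = (\<Sum>x\<in>hd ` (\<Union>i<m. ?L i). outside_degree X x)"
    using sum.reindex[OF inj', of "outside_degree X"] by (simp add: comp_def)
  also have "\<dots> \<le> (\<Sum>x\<in>X. outside_degree X x)"
    using finX Y by (intro sum_mono2) fastforce+
  finally show "(\<Sum>i<m. \<Sum>p\<in>?L i. outside_degree X (hd p)) \<le> (\<Sum>x\<in>X. outside_degree X x)" .
qed

text \<open>If every vertex of \<open>X\<close> had a neighbour outside, then \<open>X\<close> would
  have at most \<open>d\<close> vertices. Each of them has at most \<open>card X - 1\<close>
  neighbours inside, so at least \<open>card X * (d + 2 - card X)\<close> arcs would leave
  \<open>X\<close>, which exceeds \<open>d\<close>.\<close>

lemma interior_vertex:
  assumes X: "X \<subseteq> pverts G" "X \<noteq> {}" and deg: "min_degree G = Suc d"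
    and few: "(\<Sum>x\<in>X. outside_degree X x) \<le> d"
  shows "\<exists>u\<in>X. outside_degree X u = 0"
proof (rule ccontr)
  assume "\<not> ?thesis"
  then have pos: "outside_degree X x \<ge> 1" if "x \<in> X" for x using that by (simp add: Suc_le_eq)
  have finX: "finite X" using X(1) pair_finite_verts by (rule finite_subset)
  have "card X * 1 \<le> (\<Sum>x\<in>X. outside_degree X x)" using pos sum_mono[of X "\<lambda>_. 1" "outside_degree X"] by simp
  then have "card X \<le> d" using few by simp
  obtain a where a: "card X = Suc a" using X finX by (cases "card X") auto
  have "d + 1 - a \<le> outside_degree X x" if "x \<in> X" for x
  proof -
    have "parcs G `` {x} \<subseteq> (X - {x}) \<union> (parcs G `` {x} - X)" by (auto dest: no_loops')
    then have "card (parcs G `` {x}) \<le> card ((X - {x}) \<union> (parcs G `` {x} - X))"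
      using finX by (intro card_mono) auto
    also have "\<dots> \<le> card (X - {x}) + outside_degree X x" unfolding outside_degree_def by (rule card_Un_le)
    finally have "Suc d \<le> a + outside_degree X x"
      using min_degree_le[of x] X that deg a finX by auto
    then show ?thesis by simp
  qed
  then have "Suc a * (d + 1 - a) \<le> (\<Sum>x\<in>X. outside_degree X x)"
    using sum_mono[of X "\<lambda>_. d + 1 - a" "outside_degree X"] a by simp
  then have "Suc a * (d + 1 - a) \<le> d" using few by simp
  moreover obtain b where b: "d = Suc a + b" using \<open>card X \<le> d\<close> le_Suc_ex[of "Suc a" d] a by auto
  then have "d + 1 - a = b + 2" by simp
  ultimately have "Suc a * (b + 2) \<le> Suc a + b" using b by metis
  then show False by (simp add: algebra_simps)
qed

lemma short_nb_walk_unique: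
  assumes "nb_walk (parcs G) p" "nb_walk (parcs G) q" "p \<noteq> []" "q \<noteq> []"
    "hd p = hd q" "last p = last q" "length p + length q \<le> Suc (girth G)"
  shows "p = q"
  by (rule nb_walk_unique[OF sym_parcs distinct_short_nb_walk assms])

text \<open>The tree is rooted at an interior vertex \<open>u\<close>, so the first level loses
  nothing; \<open>Suc m\<close> is the number \<open>t\<close> from \<open>n1_star\<close>.\<close>

lemma side_large_odd:
  assumes X: "X \<subseteq> pverts G" "X \<noteq> {}" and deg: "min_degree G = Suc d" and d: "d \<ge> 1"
    and few: "(\<Sum>x\<in>X. outside_degree X x) \<le> d" and g: "girth G = 2 * Suc m + 1"
  shows "2 + d + (\<Sum>i=2..Suc m. d ^ i) \<le> card X"
proof -
  obtain u where u: "u \<in> X" "outside_degree X u = 0" using interior_vertex[OF X deg few] by blast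
  have finX: "finite X" using X(1) pair_finite_verts by (rule finite_subset)
  then have NX: "parcs G `` {u} \<subseteq> X" using u(2) by (auto simp: outside_degree_def)
  define R where "R = (\<lambda>x. [x, u]) ` (parcs G `` {u})"
  let ?L = "nb_level (parcs G) X R"
  have R: "finite R" "\<And>r. r \<in> R \<Longrightarrow> length r = 2 \<and> hd r \<in> X" using NX by (auto simp: R_def)
  have L: "nb_walk (parcs G) p \<and> last p = u \<and> length p = i + 2 \<and> hd p \<in> X"
    if "p \<in> ?L i" for p i
  proof -
    obtain q r where "p = q @ r" "r \<in> R" "length q = i" "set q \<subseteq> X" "nb_walk (parcs G) p"
      using \<open>p \<in> ?L i\<close> by (auto simp: nb_level_def)
    then show ?thesis using NX by (cases q) (auto simp: R_def)
  qed
  have inj: "inj_on hd (\<Union>i\<le>m. ?L i)"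
  proof (rule inj_onI)
    fix p q assume "p \<in> (\<Union>i\<le>m. ?L i)" "q \<in> (\<Union>i\<le>m. ?L i)" "hd p = hd q"
    then obtain i j where "p \<in> ?L i" "q \<in> ?L j" "i \<le> m" "j \<le> m" by auto
    \<comment> \<open>Each walk has at most \<open>m + 2\<close> vertices, together
      \<open>2 * m + 4\<close>, which is exactly the girth plus one.\<close>
    then show "p = q" using L[of p i] L[of q j] g \<open>hd p = hd q\<close>
      by (intro short_nb_walk_unique) auto
  qed
  \<comment> \<open>The root is never a head, hence it adds one more vertex to the count.\<close>
  have Y: "hd p \<in> X - {u}" if p: "p \<in> (\<Union>i\<le>m. ?L i)" for p
  proof -
    obtain i where i: "p \<in> ?L i" "i \<le> m" using p by auto
    then have "distinct p" using L[of p i] g by (intro distinct_short_nb_walk) auto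
    moreover obtain x xs where "p = x # xs" "xs \<noteq> []"
      using L[OF i(1)] by (cases p; cases "tl p") auto
    ultimately have "hd p \<noteq> last p" using last_in_set[of xs] by auto
    then show ?thesis using L[OF i(1)] by auto
  qed
  note sums = nb_levels_in_side[OF X(1) R inj Y, simplified]
  have "card (?L 0) = card (parcs G `` {u})"
  proof -
    have "?L 0 = R" by (auto simp: nb_level_def R_def intro: arcs_symmetric)
    then show ?thesis by (auto simp: R_def card_image inj_on_def)
  qed
  then have "Suc d \<le> card (?L 0)" using min_degree_le[of u] u X deg by auto
  moreover have "d * card (?L i) \<le> card (?L (Suc i)) + (\<Sum>p\<in>?L i. outside_degree X (hd p))" for i
    using R by (intro nb_level_growth[OF X(1) R(1) _ deg]) auto
  moreover have "(\<Sum>i<m. \<Sum>p\<in>?L i. outside_degree X (hd p)) \<le> d" using sums(2) few by simp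
  ultimately have "Suc d + (\<Sum>i=2..Suc m. d ^ i) \<le> (\<Sum>i\<le>m. card (?L i))"
    using d by (intro odd_growth_sum) auto
  also have "\<dots> \<le> card X - 1" using sums(1) u by simp
  finally show ?thesis using u finX by (cases "card X") auto
qed

text \<open>Two trees are grown from the ends of an edge \<open>uv\<close> with both ends interior,
  each avoiding that edge.\<close>

lemma side_large_even:
  assumes X: "X \<subseteq> pverts G" "X \<noteq> {}" and deg: "min_degree G = Suc d" and d: "d \<ge> 1"
    and few: "(\<Sum>x\<in>X. outside_degree X x) \<le> d" and g: "girth G = 2 * m + 2" and m: "m \<ge> 1"
  shows "2 + 2 * d ^ m + (\<Sum>i=1..m - 1. d ^ i) \<le> card X"
proof -
  obtain u where u: "u \<in> X" "outside_degree X u = 0" using interior_vertex[OF X deg few] by blast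
  have finX: "finite X" using X(1) pair_finite_verts by (rule finite_subset)
  then have NX: "parcs G `` {u} \<subseteq> X" using u(2) by (auto simp: outside_degree_def)
  \<comment> \<open>All of the at least \<open>d + 1\<close> neighbours of \<open>u\<close> lie in
    \<open>X\<close>; if none were interior, more than \<open>d\<close> arcs would leave
    \<open>X\<close>.\<close>
  have "\<exists>v. (u, v) \<in> parcs G \<and> outside_degree X v = 0"
  proof (rule ccontr)
    assume "\<not> ?thesis"
    then have "(\<Sum>x\<in>parcs G `` {u}. 1) \<le> (\<Sum>x\<in>parcs G `` {u}. outside_degree X x)"
      by (intro sum_mono) (auto simp: Suc_le_eq)
    also have "\<dots> \<le> (\<Sum>x\<in>X. outside_degree X x)" using NX finX by (intro sum_mono2) auto
    finally show False using min_degree_le[of u] u X deg few by auto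
  qed
  then obtain v where v: "(u, v) \<in> parcs G" "outside_degree X v = 0" by blast
  then have "v \<in> X" "u \<noteq> v" "(v, u) \<in> parcs G" using NX by (auto dest: no_loops' arcs_symmetric)
  define R where "R = {[u, v], [v, u]}"
  let ?L = "nb_level (parcs G) X R"
  have R: "finite R" "\<And>r. r \<in> R \<Longrightarrow> length r = 2 \<and> hd r \<in> X"
    using u \<open>v \<in> X\<close> by (auto simp: R_def)
  have L: "\<exists>q. nb_walk (parcs G) p \<and> (p = q @ [u, v] \<or> p = q @ [v, u]) \<and> length q = i \<and> set q \<subseteq> X"
    if "p \<in> ?L i" for p i
    using that by (auto simp: nb_level_def R_def)
  \<comment> \<open>Walks from different ends, joined across the edge, form one walk on at most
    \<open>2 * m + 2\<close> vertices, which is the girth, so they cannot meet.\<close>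
  have no_mix: "hd (p @ [u, v]) \<noteq> hd (q @ [v, u])"
    if "nb_walk (parcs G) (p @ [u, v])" "nb_walk (parcs G) (q @ [v, u])" "length p \<le> m" "length q \<le> m"
    for p q
  proof
    assume eq: "hd (p @ [u, v]) = hd (q @ [v, u])"
    have "nb_walk (parcs G) (u # v # rev q)" using nb_walk_rev[OF sym_parcs that(2)] by simp
    with that(1) have "nb_walk (parcs G) (p @ u # v # rev q)" 
      using nb_walk_append[of "parcs G" p u v "rev q"] by blast
    then have "distinct (p @ u # v # rev q)" using that g by (intro distinct_short_nb_walk) auto
    then have "set (p @ [u]) \<inter> set (q @ [v]) = {}" by auto
    moreover have "hd (p @ [u, v]) \<in> set (p @ [u])" "hd (q @ [v, u]) \<in> set (q @ [v])"
      by (cases p; auto) (cases q; auto)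
    ultimately show False using eq by (metis disjoint_iff)
  qed
  have same: "p = q"
    if "nb_walk (parcs G) (p @ [x, y])" "nb_walk (parcs G) (q @ [x, y])" "length p \<le> m" "length q \<le> m"
      "hd (p @ [x, y]) = hd (q @ [x, y])" for p q x y
  proof -
    \<comment> \<open>Uniqueness is applied without the common last vertex \<open>y\<close>: the
      full walks could have \<open>2 * m + 4\<close> vertices together, one too many for it.\<close>
    have "p @ [x] = q @ [x]"
    proof (rule short_nb_walk_unique)
      show "nb_walk (parcs G) (p @ [x])" "nb_walk (parcs G) (q @ [x])"
        using that(1,2) nb_walk_appendD(1)[of _ "_ @ [x]" "[y]"] by auto
      show "hd (p @ [x]) = hd (q @ [x])" using that(5) by (cases p; cases q) auto
    qed (use that g in auto)
    then show ?thesis by simp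
  qed
  have inj: "inj_on hd (\<Union>i\<le>m. ?L i)"
  proof (rule inj_onI)
    fix p q assume "p \<in> (\<Union>i\<le>m. ?L i)" "q \<in> (\<Union>i\<le>m. ?L i)" and eq: "hd p = hd q"
    then obtain i j where ij: "p \<in> ?L i" "q \<in> ?L j" "i \<le> m" "j \<le> m" by auto
    obtain p' where p': "nb_walk (parcs G) p" "p = p' @ [u, v] \<or> p = p' @ [v, u]" "length p' = i"
      using L[OF ij(1)] by blast
    obtain q' where q': "nb_walk (parcs G) q" "q = q' @ [u, v] \<or> q = q' @ [v, u]" "length q' = j"
      using L[OF ij(2)] by blast
    show "p = q"
      using p' q' ij(3,4) eq no_mix[of p' q'] no_mix[of q' p'] same[of p' u v q'] same[of p' v u q']
      by auto
  qed
  have Y: "hd p \<in> X" if p: "p \<in> (\<Union>i\<le>m. ?L i)" for p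
  proof -
    obtain i where "p \<in> ?L i" using p by auto
    from L[OF this] obtain q where "p = q @ [u, v] \<or> p = q @ [v, u]" "set q \<subseteq> X" by blast
    then show ?thesis using u \<open>v \<in> X\<close> by (cases q) auto
  qed
  note sums = nb_levels_in_side[OF X(1) R inj Y order_refl]
  have L0: "?L 0 = R" using v \<open>(v, u) \<in> parcs G\<close> by (auto simp: nb_level_def R_def)
  then have "card (?L 0) = 2" using \<open>u \<noteq> v\<close> by (simp add: R_def)
  \<comment> \<open>Both roots end in interior vertices, which is the condition
    \<open>c 0 = 0\<close> of the growth bound.\<close>
  moreover have "(\<Sum>p\<in>?L 0. outside_degree X (hd p)) = 0" unfolding L0 using u v by (auto simp: R_def)
  moreover have "d * card (?L i) \<le> card (?L (Suc i)) + (\<Sum>p\<in>?L i. outside_degree X (hd p))" for i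
    using R by (intro nb_level_growth[OF X(1) R(1) _ deg]) auto
  moreover have "(\<Sum>i<m. \<Sum>p\<in>?L i. outside_degree X (hd p)) \<le> d" using sums(2) few by simp
  ultimately have "2 + 2 * d ^ m + (\<Sum>i=1..m - 1. d ^ i) \<le> (\<Sum>i\<le>m. card (?L i))"
    using d m by (intro even_growth_sum) auto
  also have "\<dots> \<le> card X" by (rule sums(1))
  finally show ?thesis .
qed

theorem n1_star_le_card_side:
  assumes X: "X \<subseteq> pverts G" "X \<noteq> {}" and deg: "min_degree G \<ge> 2"
    and few: "(\<Sum>x\<in>X. outside_degree X x) < min_degree G"
  shows "n1_star (min_degree G) (girth G) \<le> card X"
proof -
  obtain d where d: "min_degree G = Suc d" "d \<ge> 1" using deg by (cases "min_degree G") auto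
  have few': "(\<Sum>x\<in>X. outside_degree X x) \<le> d" using few d by simp
  have g: "girth G \<ge> 3" using girth_ge_3 X deg by auto
  define t where "t = (girth G - 1) div 2"
  show ?thesis
  proof (cases "girth G = 2 * t + 1")
    case True
    then obtain m where "t = Suc m" using g by (cases t) auto
    with True side_large_odd[OF X d few', of m] show ?thesis
      by (simp add: n1_star_def d(1) Let_def)
  next
    case False
    then have "girth G = 2 * t + 2" "t \<ge> 1" using g unfolding t_def by presburger+
    from side_large_even[OF X d few' this] show ?thesis using False
      unfolding n1_star_def d(1) Let_def t_def[symmetric] by simp
  qed
qed

end

section \<open>Edge cuts and quadratic forms\<close>

context pair_graph
begin

section \<open>Edge connectivity and cuts of the vertex set\<close>

lemma sum_outside_eq_card:
  assumes "X \<subseteq> pverts G"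
  shows "(\<Sum>x\<in>X. outside_degree X x) = card {(x, w) \<in> parcs G. x \<in> X \<and> w \<notin> X}"
proof -
  have "(\<Sum>x\<in>X. outside_degree X x) = card (SIGMA x:X. parcs G `` {x} - X)"
    unfolding outside_degree_def using finite_subset[OF assms pair_finite_verts] by (subst card_SigmaI) auto
  also have "(SIGMA x:X. parcs G `` {x} - X) = {(x, w) \<in> parcs G. x \<in> X \<and> w \<notin> X}" by auto
  finally show ?thesis .
qed

lemma sum_outside_complement:
  assumes "X \<subseteq> pverts G"
  shows "(\<Sum>x\<in>pverts G - X. outside_degree (pverts G - X) x) = (\<Sum>x\<in>X. outside_degree X x)"
proof -
  have "{(x, w) \<in> parcs G. x \<in> pverts G - X \<and> w \<notin> pverts G - X} =
      {(x, w) \<in> parcs G. x \<in> X \<and> w \<notin> X}\<inverse>"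
    using assms by (auto intro: arcs_symmetric dest: in_arcsD1 in_arcsD2)
  then show ?thesis
    using assms by (simp add: sum_outside_eq_card)
qed

text \<open>Take for \<open>X\<close> the vertices still reachable from \<open>u\<close> after the
  deletion: any arc of \<open>G\<close> that leaves \<open>X\<close> must have had its edge
  deleted.\<close>

lemma disconnected_imp_cut:
  assumes "pverts G \<noteq> {}" "\<not> connected (with_proj (del_edges G F))" "finite F"
  obtains X where "X \<subseteq> pverts G" "X \<noteq> {}" "X \<noteq> pverts G" "(\<Sum>x\<in>X. outside_degree X x) \<le> card F"
proof -
  \<comment> \<open>\<open>connected\<close> is strong connectivity of the symmetrised digraph and
    includes having a vertex, so the empty graph has to be excluded.\<close>
  let ?H = "mk_symmetric (with_proj (del_edges G F))"
  have verts: "pverts ?H = pverts G" by (simp add: del_edges_def)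
  obtain u v where uv: "u \<in> pverts G" "v \<in> pverts G" "(u, v) \<notin> rtrancl_on (pverts G) (parcs ?H)"
    using assms(1,2) verts
    by (auto simp: connected_def strongly_connected_def reachable_def)
  define X where "X = {w \<in> pverts G. (u, w) \<in> rtrancl_on (pverts G) (parcs ?H)}"
  have cut: "{x, w} \<in> F" if "(x, w) \<in> parcs G" "x \<in> X" "w \<notin> X" for x w
  proof (rule ccontr)
    assume "{x, w} \<notin> F"
    then have "(x, w) \<in> parcs ?H" using that by (force simp: parcs_mk_symmetric del_edges_def)
    moreover have "w \<in> pverts G" using that by (auto dest: in_arcsD2)
    ultimately have "w \<in> X" using that(2) by (auto simp: X_def intro: rtrancl_on_into_rtrancl_on)
    then show False using that by simp
  qed
  \<comment> \<open>An arc from \<open>X\<close> to its complement is recovered from its edge,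
    because only one end lies in \<open>X\<close>.\<close>
  have "card {(x, w) \<in> parcs G. x \<in> X \<and> w \<notin> X} \<le> card F"
    using cut assms(3)
    by (intro card_inj_on_le[of "\<lambda>(x, w). {x, w}"]) (auto simp: inj_on_def doubleton_eq_iff)
  moreover have "X \<subseteq> pverts G" "u \<in> X" "v \<notin> X" using uv by (auto simp: X_def)
  ultimately show thesis using that[of X] uv sum_outside_eq_card[of X] by auto
qed

text \<open>Deleting all edges separates two distinct vertices, so the infimum is attained by an
  actual edge set instead of being the default \<open>Inf {} = 0\<close>.\<close>

lemma edge_connectivity_cut:
  assumes "card (pverts G) \<ge> 2"
  obtains X where "X \<subseteq> pverts G" "X \<noteq> {}" "X \<noteq> pverts G"
    "(\<Sum>x\<in>X. outside_degree X x) \<le> edge_connectivity G"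
proof -
  let ?S = "{card F |F. F \<subseteq> edges G \<and> \<not> connected (with_proj (del_edges G F))}"
  obtain u v where uv: "u \<in> pverts G" "v \<in> pverts G" "u \<noteq> v"
    using assms by (metis card_le_Suc0_iff_eq not_less_eq_eq numeral_2_eq_2 pair_finite_verts)
  let ?H = "mk_symmetric (with_proj (del_edges G (edges G)))"
  have H: "parcs ?H = {}" "pverts ?H = pverts G"
    by (auto simp: parcs_mk_symmetric del_edges_def edges_def)
  have "\<not> connected (with_proj (del_edges G (edges G)))"
  proof
    assume "connected (with_proj (del_edges G (edges G)))"
    then have "u \<rightarrow>\<^sup>*\<^bsub>with_proj ?H\<^esub> v"
      using uv H(2) by (simp add: connected_def strongly_connected_def)
    from reachable_rtranclI[OF this] show False using H(1) uv(3) by simp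
  qed
  then have "?S \<noteq> {}" by blast
  from Inf_nat_def1[OF this] obtain F where F: "F \<subseteq> edges G" "card F = edge_connectivity G"
    "\<not> connected (with_proj (del_edges G F))"
    by (auto simp: edge_connectivity_def)
  have "edges G = (\<lambda>(u, v). {u, v}) ` parcs G" by (auto simp: edges_def)
  then have "finite F" using F(1) pair_finite_arcs by (metis finite_imageI finite_subset)
  then show thesis using disconnected_imp_cut[OF _ F(3)] uv F(2) that by auto
qed

section \<open>Matrices of a graph acting on functions of its vertices\<close>

lemma vertex_list: "distinct (vertex_list G)" "set (vertex_list G) = pverts G"
  "length (vertex_list G) = card (pverts G)"
proof -
  have *: "distinct (vertex_list G) \<and> set (vertex_list G) = pverts G"
    unfolding vertex_list_def
    by (rule someI_ex) (use finite_distinct_list[OF pair_finite_verts] in blast)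
  then show "distinct (vertex_list G)" "set (vertex_list G) = pverts G" by auto
  then show "length (vertex_list G) = card (pverts G)" by (metis distinct_card)
qed

definition vertex_vec :: "('a \<Rightarrow> real) \<Rightarrow> real vec" where
  "vertex_vec h = vec (card (pverts G)) (\<lambda>i. h (vertex_list G ! i))"

lemma vertex_vec_carrier [simp]: "vertex_vec h \<in> carrier_vec (card (pverts G))"
  by (simp add: vertex_vec_def)

lemma sum_vertex_list: "(\<Sum>i<card (pverts G). h (vertex_list G ! i)) = sum h (pverts G)"
  using sum.reindex_bij_betw[OF bij_betw_nth[OF vertex_list(1) _ vertex_list(2)[symmetric]], of "{..<card (pverts G)}" h]
  by (simp add: vertex_list(3))

lemma vertex_vec_scalar_prod: "vertex_vec h \<bullet> vertex_vec h' = (\<Sum>v\<in>pverts G. h v * h' v)"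
  using sum_vertex_list[of "\<lambda>v. h v * h' v"]
  by (simp add: vertex_vec_def scalar_prod_def atLeast0LessThan)

text \<open>A common family for the three matrices, so that quadratic forms and eigenvalue equations
  are computed once.\<close>

definition graph_mat :: "real \<Rightarrow> real \<Rightarrow> real mat" where
  "graph_mat \<alpha> \<beta> = \<alpha> \<cdot>\<^sub>m degree_matrix G + \<beta> \<cdot>\<^sub>m adjacency_matrix G"

lemma graph_mat_carrier [simp]:
  "graph_mat \<alpha> \<beta> \<in> carrier_mat (card (pverts G)) (card (pverts G))"
  by (simp add: graph_mat_def degree_matrix_def adjacency_matrix_def Let_def)

lemma graph_mat_special:
  "adjacency_matrix G = graph_mat 0 1"
  "laplacian_matrix G = graph_mat 1 (-1)"
  "signless_laplacian_matrix G = graph_mat 1 1"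
  by (auto simp: graph_mat_def laplacian_matrix_def signless_laplacian_matrix_def
      degree_matrix_def adjacency_matrix_def Let_def intro!: eq_matI)

lemma graph_mat_symmetric: "transpose_mat (graph_mat \<alpha> \<beta>) = graph_mat \<alpha> \<beta>"
  by (auto simp: graph_mat_def degree_matrix_def adjacency_matrix_def Let_def
      intro!: eq_matI intro: arcs_symmetric)

lemma graph_mat_mult_vertex_vec:
  "graph_mat \<alpha> \<beta> *\<^sub>v vertex_vec h = vertex_vec (\<lambda>v.
    \<alpha> * card (parcs G `` {v}) * h v + \<beta> * (\<Sum>w\<in>parcs G `` {v}. h w))"
proof (rule Matrix.eq_vecI)
  let ?n = "card (pverts G)" and ?vs = "vertex_list G"
  fix i assume "i < dim_vec (vertex_vec (\<lambda>v.
    \<alpha> * card (parcs G `` {v}) * h v + \<beta> * (\<Sum>w\<in>parcs G `` {v}. h w)))"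
  then have i: "i < ?n" by (simp add: vertex_vec_def)
  then have "?vs ! i \<in> pverts G" using vertex_list by (metis nth_mem)
  have eq: "?vs ! i = ?vs ! j \<longleftrightarrow> i = j" if "j < ?n" for j
    using i that vertex_list by (simp add: nth_eq_iff_index_eq)
  have "(graph_mat \<alpha> \<beta> *\<^sub>v vertex_vec h) $ i = (\<Sum>j<?n.
      (\<lambda>w. (\<alpha> * (if ?vs ! i = w then real (card (parcs G `` {?vs ! i})) else 0)
        + \<beta> * (if (?vs ! i, w) \<in> parcs G then 1 else 0)) * h w) (?vs ! j))"
    using i eq
    by (simp add: graph_mat_def degree_matrix_def adjacency_matrix_def Let_def vertex_vec_def
        scalar_prod_def atLeast0LessThan out_degree_eq_card cong: if_cong)
  also have "\<dots> = (\<Sum>w\<in>pverts G. (\<alpha> * (if ?vs ! i = w then real (card (parcs G `` {?vs ! i})) else 0)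
        + \<beta> * (if (?vs ! i, w) \<in> parcs G then 1 else 0)) * h w)"
    by (rule sum_vertex_list)
  also have "\<dots> = (\<Sum>w\<in>pverts G. if ?vs ! i = w then \<alpha> * card (parcs G `` {?vs ! i}) * h w else 0)
      + (\<Sum>w\<in>pverts G. if w \<in> parcs G `` {?vs ! i} then \<beta> * h w else 0)"
    unfolding sum.distrib[symmetric] by (intro sum.cong) (auto simp: algebra_simps)
  also have "(\<Sum>w\<in>pverts G. if ?vs ! i = w then \<alpha> * card (parcs G `` {?vs ! i}) * h w else 0)
      = \<alpha> * card (parcs G `` {?vs ! i}) * h (?vs ! i)"
    using \<open>?vs ! i \<in> pverts G\<close> pair_finite_verts by (simp add: sum.delta')
  also have "(\<Sum>w\<in>pverts G. if w \<in> parcs G `` {?vs ! i} then \<beta> * h w else 0)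
      = \<beta> * (\<Sum>w\<in>parcs G `` {?vs ! i}. h w)"
  proof -
    have "pverts G \<inter> parcs G `` {?vs ! i} = parcs G `` {?vs ! i}" by (auto dest: in_arcsD2)
    then show ?thesis
      unfolding sum.inter_restrict[OF pair_finite_verts, symmetric] by (simp add: sum_distrib_left)
  qed
  finally show "(graph_mat \<alpha> \<beta> *\<^sub>v vertex_vec h) $ i = vertex_vec (\<lambda>v.
      \<alpha> * card (parcs G `` {v}) * h v + \<beta> * (\<Sum>w\<in>parcs G `` {v}. h w)) $ i"
    using i by (simp add: vertex_vec_def)
qed (simp add: vertex_vec_def graph_mat_def degree_matrix_def adjacency_matrix_def Let_def)

definition two_valued :: "'a set \<Rightarrow> real \<Rightarrow> real \<Rightarrow> 'a \<Rightarrow> real" where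
  "two_valued X p q v = (if v \<in> X then p else q)"

text \<open>Compare each neighbour with \<open>v\<close> itself: the values differ only across the
  cut, and there by a fixed amount.\<close>

lemma sum_nbrs_two_valued:
  fixes p q :: real
  assumes "X \<subseteq> pverts G" "v \<in> pverts G"
  shows "(\<Sum>w\<in>parcs G `` {v}. two_valued X p q w) = card (parcs G `` {v}) * two_valued X p q v +
    (if v \<in> X then (q - p) * outside_degree X v else (p - q) * outside_degree (pverts G - X) v)"
proof -
  have "(\<Sum>w\<in>parcs G `` {v}. two_valued X p q w) = card (parcs G `` {v}) * two_valued X p q v
      + (\<Sum>w\<in>parcs G `` {v}. two_valued X p q w - two_valued X p q v)"
    by (simp add: sum_subtractf)
  also have "(\<Sum>w\<in>parcs G `` {v}. two_valued X p q w - two_valued X p q v) =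
      (if v \<in> X then (q - p) * outside_degree X v else (p - q) * outside_degree (pverts G - X) v)"
  proof (cases "v \<in> X")
    case True
    then have "(\<Sum>w\<in>parcs G `` {v}. two_valued X p q w - two_valued X p q v)
        = (\<Sum>w\<in>parcs G `` {v} - X. q - p)"
      by (intro sum.mono_neutral_cong_right) (auto simp: two_valued_def)
    then show ?thesis using True by (simp add: outside_degree_def)
  next
    case False
    then have "(\<Sum>w\<in>parcs G `` {v}. two_valued X p q w - two_valued X p q v)
        = (\<Sum>w\<in>parcs G `` {v} - (pverts G - X). p - q)"
      by (intro sum.mono_neutral_cong_right) (auto simp: two_valued_def dest: in_arcsD2)
    then show ?thesis using False by (simp add: outside_degree_def)
  qed
  finally show ?thesis .
qed

text \<open>The arcs across the cut contribute \<open>p * (q - p)\<close> from the side of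
  \<open>X\<close> and \<open>q * (p - q)\<close> from the other. Both sides have equally many such
  arcs, and the two coefficients add up to \<open>- (p - q)\<^sup>2\<close>.\<close>

lemma graph_mat_quadratic_form:
  fixes p q :: real
  assumes X: "X \<subseteq> pverts G"
  defines "z \<equiv> vertex_vec (two_valued X p q)"
  shows "z \<bullet> (graph_mat \<alpha> \<beta> *\<^sub>v z) =
    (\<alpha> + \<beta>) * (\<Sum>v\<in>pverts G. card (parcs G `` {v}) * (two_valued X p q v)\<^sup>2)
      - \<beta> * real (\<Sum>x\<in>X. outside_degree X x) * (p - q)\<^sup>2"
proof -
  let ?h = "two_valued X p q" and ?V = "pverts G"
  have "z \<bullet> (graph_mat \<alpha> \<beta> *\<^sub>v z) = (\<Sum>v\<in>?V. ?h v *
      (\<alpha> * card (parcs G `` {v}) * ?h v + \<beta> * (\<Sum>w\<in>parcs G `` {v}. ?h w)))"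
    unfolding z_def graph_mat_mult_vertex_vec by (rule vertex_vec_scalar_prod)
  also have "\<dots> = (\<Sum>v\<in>?V. (\<alpha> + \<beta>) * (card (parcs G `` {v}) * (?h v)\<^sup>2) +
      \<beta> * (?h v * (if v \<in> X then (q - p) * outside_degree X v else (p - q) * outside_degree (?V - X) v)))"
    by (intro sum.cong refl, subst sum_nbrs_two_valued[OF X])
      (auto simp: algebra_simps power2_eq_square)
  also have "\<dots> = (\<alpha> + \<beta>) * (\<Sum>v\<in>?V. card (parcs G `` {v}) * (?h v)\<^sup>2) + \<beta> *
      (\<Sum>v\<in>?V. ?h v * (if v \<in> X then (q - p) * outside_degree X v else (p - q) * outside_degree (?V - X) v))"
    by (simp only: sum.distrib sum_distrib_left)
  also have "(\<Sum>v\<in>?V. ?h v * (if v \<in> X then (q - p) * outside_degree X v else (p - q) * outside_degree (?V - X) v))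
      = (\<Sum>v\<in>X. p * (q - p) * outside_degree X v) + (\<Sum>v\<in>?V - X. q * (p - q) * outside_degree (?V - X) v)"
    unfolding sum.subset_diff[OF X pair_finite_verts] add.commute[of "sum _ (?V - X)"]
    by (intro arg_cong2[of _ _ _ _ "(+)"] sum.cong) (auto simp: two_valued_def)
  also have "\<dots> = p * (q - p) * real (\<Sum>v\<in>X. outside_degree X v)
      + q * (p - q) * real (\<Sum>v\<in>?V - X. outside_degree (?V - X) v)"
    by (simp add: sum_distrib_left)
  also have "\<dots> = - real (\<Sum>v\<in>X. outside_degree X v) * (p - q)\<^sup>2"
    unfolding sum_outside_complement[OF X] by (simp add: algebra_simps power2_eq_square)
  finally show ?thesis by simp
qed

text \<open>Around an interior vertex the vector is constant, so the eigenvalue equation in that row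
  involves only the degree.\<close>

lemma graph_mat_eigenvector_interior:
  assumes X: "X \<subseteq> pverts G" and v: "v \<in> pverts G"
    and int: "if v \<in> X then outside_degree X v = 0 else outside_degree (pverts G - X) v = 0"
    and eig: "graph_mat \<alpha> \<beta> *\<^sub>v vertex_vec (two_valued X p q) = \<theta> \<cdot>\<^sub>v vertex_vec (two_valued X p q)"
  shows "(\<alpha> + \<beta>) * card (parcs G `` {v}) * two_valued X p q v = \<theta> * two_valued X p q v"
proof -
  obtain i where i: "i < card (pverts G)" "v = vertex_list G ! i"
    using v vertex_list by (metis in_set_conv_nth)
  have "\<alpha> * card (parcs G `` {v}) * two_valued X p q v
      + \<beta> * (\<Sum>w\<in>parcs G `` {v}. two_valued X p q w) = \<theta> * two_valued X p q v"
    using arg_cong[OF eig, of "\<lambda>z. z $ i"] i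
    unfolding graph_mat_mult_vertex_vec by (simp add: vertex_vec_def)
  moreover have "(\<Sum>w\<in>parcs G `` {v}. two_valued X p q w) = card (parcs G `` {v}) * two_valued X p q v"
    using sum_nbrs_two_valued[OF X v] int by (auto split: if_splits)
  ultimately show ?thesis by (simp add: algebra_simps)
qed

lemma sum_two_valued_squares:
  fixes p q :: real
  assumes "X \<subseteq> pverts G"
  shows "(\<Sum>v\<in>pverts G. (two_valued X p q v)\<^sup>2) = card X * p\<^sup>2 + card (pverts G - X) * q\<^sup>2"
  unfolding sum.subset_diff[OF assms pair_finite_verts] by (simp add: two_valued_def)

end

text \<open>The difference \<open>(a + b) * (a * p\<^sup>2 + b * q\<^sup>2) - a * b * (p -
  q)\<^sup>2\<close> is the square of \<open>a * p + b * q\<close>, and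
  \<open>(a - m) * (b - m) \<ge> 0\<close> gives \<open>m * (a + b - m) \<le> a * b\<close>. In the
  application \<open>a\<close> and \<open>b\<close> are the sizes of the sides and \<open>m\<close>
  is their lower bound.\<close>

lemma cut_quotient_bound:
  fixes a b m e c p q :: real
  assumes "0 < m" "m \<le> a" "m \<le> b" "0 \<le> e" "e \<le> c"
  shows "e * (p - q)\<^sup>2 \<le> c * (a + b) / (m * (a + b - m)) * (a * p\<^sup>2 + b * q\<^sup>2)"
proof -
  define S where "S = a * p\<^sup>2 + b * q\<^sup>2"
  have S: "0 \<le> S" unfolding S_def using assms by simp
  have D: "0 < m * (a + b - m)" using assms by simp
  have "0 \<le> (a - m) * (b - m)" using assms by simp
  then have ab: "m * (a + b - m) \<le> a * b" by (simp add: algebra_simps)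
  have "(a + b) * S - a * b * (p - q)\<^sup>2 = (a * p + b * q)\<^sup>2"
    by (simp add: S_def algebra_simps power2_eq_square)
  then have "a * b * (p - q)\<^sup>2 \<le> (a + b) * S" using zero_le_power2[of "a * p + b * q"] by linarith
  moreover have "m * (a + b - m) * (p - q)\<^sup>2 \<le> a * b * (p - q)\<^sup>2"
    using ab by (rule mult_right_mono) simp
  ultimately have *: "m * (a + b - m) * (p - q)\<^sup>2 \<le> (a + b) * S" by linarith
  have "e * (p - q)\<^sup>2 * (m * (a + b - m)) = e * (m * (a + b - m) * (p - q)\<^sup>2)" by simp
  also have "\<dots> \<le> c * ((a + b) * S)"
    using assms * D by (intro mult_mono[of e c]) auto
  finally show ?thesis using D unfolding S_def[symmetric]
    by (simp add: pos_le_divide_eq mult.assoc)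
qed

theorem corollary3p6:
  fixes G :: "'a pair_pre_digraph" and k n g \<delta> :: nat and n1 :: real
  assumes "pair_graph G"
    and "pverts G \<noteq> {}"
    and "k \<ge> 2"
    and "n = card (pverts G)"
    and "g = girth G"
    and "\<delta> = min_degree G"
    and "\<delta> \<ge> k"
    and "n1 = real (n1_star \<delta> g)"
  shows "(adj_eigenvalue G 2 \<le> real \<delta> - (real k - 1) * real n / (n1 * (real n - n1))
            \<longrightarrow> edge_connectivity G \<ge> k)
       \<and> (lap_eigenvalue G (n - 1) \<ge> (real k - 1) * real n / (n1 * (real n - n1))
            \<longrightarrow> edge_connectivity G \<ge> k)
       \<and> (signless_lap_eigenvalue G 2 \<le> 2 * real \<delta> - (real k - 1) * real n / (n1 * (real n - n1))
            \<longrightarrow> edge_connectivity G \<ge> k)"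
proof (cases "edge_connectivity G \<ge> k")
  case False
  interpret pair_graph G by fact
  \<comment> \<open>With the connectivity below \<open>k\<close>, each of the three hypotheses is
    refuted by a strict inequality against the same number \<open>\<tau>\<close>.\<close>
  define \<tau> where "\<tau> = (real k - 1) * real n / (n1 * (real n - n1))"
  have deg: "min_degree G \<ge> 2" using assms by simp
  obtain d where d: "min_degree G = Suc d" using deg by (cases "min_degree G") auto
  obtain v0 where "v0 \<in> pverts G" using assms(2) by auto
  \<comment> \<open>A vertex with two neighbours gives \<open>n \<ge> 2\<close>, so the second
    largest and second smallest eigenvalues exist and the graph can be cut.\<close>
  then have "2 \<le> card (parcs G `` {v0})" using min_degree_le[of v0] deg by simp
  also have "\<dots> \<le> card (pverts G)"
    using pair_finite_verts by (intro card_mono) (auto dest: in_arcsD2)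
  finally have n2: "n \<ge> 2" using assms(4) by simp
  obtain X where X: "X \<subseteq> pverts G" "X \<noteq> {}" "X \<noteq> pverts G"
    "(\<Sum>x\<in>X. outside_degree X x) \<le> edge_connectivity G"
    using edge_connectivity_cut n2 assms(4) by metis
  define Y where "Y = pverts G - X"
  define e where "e = (\<Sum>x\<in>X. outside_degree X x)"
  have Y: "Y \<subseteq> pverts G" "Y \<noteq> {}" using X by (auto simp: Y_def)
  have eY: "(\<Sum>x\<in>Y. outside_degree Y x) = e" unfolding Y_def e_def by (rule sum_outside_complement[OF X(1)])
  have ek: "e < k" using X(4) False by (simp add: e_def)
  then have ed: "e < min_degree G" "e \<le> d" using assms d by auto
  obtain u where u: "u \<in> X" "outside_degree X u = 0"
    using interior_vertex[OF X(1,2) d] ed by (auto simp: e_def)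
  obtain w where w: "w \<in> Y" "outside_degree Y w = 0"
    using interior_vertex[OF Y d] ed eY by auto
  have n1X: "n1 \<le> card X"
    using n1_star_le_card_side[OF X(1,2) deg] ed assms by (simp add: e_def)
  have n1Y: "n1 \<le> card Y"
    using n1_star_le_card_side[OF Y deg] ed eY assms by simp
  have n1pos: "n1 > 0" using assms by (simp add: n1_star_def Let_def)
  have "card (pverts G) = card X + card Y"
    unfolding Y_def using X(1) pair_finite_verts
    by (metis card_Diff_subset card_mono finite_subset le_add_diff_inverse)
  then have n_eq: "real n = card X + card Y" using assms(4) by simp
  have \<tau>pos: "\<tau> > 0" unfolding \<tau>_def using assms(3) n1pos n1X n1Y n_eq
    by (intro divide_pos_pos mult_pos_pos) auto
  \<comment> \<open>The cut has fewer than \<open>k\<close> edges, so \<open>k - 1\<close> serves as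
    the upper bound on \<open>e\<close>.\<close>
  have bound: "real e * (p - q)\<^sup>2 \<le> \<tau> * (card X * p\<^sup>2 + card Y * q\<^sup>2)" for p q :: real
    using cut_quotient_bound[OF n1pos n1X n1Y, of "real e" "real k - 1" p q] ek
    by (simp add: \<tau>_def n_eq)
  define x y where "x = vertex_vec (two_valued X 1 0)" and "y = vertex_vec (two_valued X 0 1)"
  have xy: "x \<in> carrier_vec n" "y \<in> carrier_vec n" using assms(4) by (auto simp: x_def y_def)
  have z: "p \<cdot>\<^sub>v x + q \<cdot>\<^sub>v y = vertex_vec (two_valued X p q)" for p q
    by (rule Matrix.eq_vecI) (auto simp: x_def y_def vertex_vec_def two_valued_def)
  have zz: "vertex_vec (two_valued X p q) \<bullet> vertex_vec (two_valued X p q)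
      = card X * p\<^sup>2 + card Y * q\<^sup>2" for p q :: real
    using sum_two_valued_squares[OF X(1)]
    by (simp add: vertex_vec_scalar_prod Y_def power2_eq_square)
  have M: "graph_mat \<alpha> \<beta> \<in> carrier_mat n n" for \<alpha> \<beta> using assms(4) by simp
  note quad = graph_mat_quadratic_form[OF X(1), folded e_def]
  \<comment> \<open>The row of the interior vertex \<open>u\<close> forces \<open>p = 0\<close> and
    that of \<open>w\<close> forces \<open>q = 0\<close>, as \<open>\<theta>\<close> differs from
    every \<open>\<alpha> + \<beta>\<close> multiple of a degree.\<close>
  have no_eigenvector: False
    if "(p, q) \<noteq> (0, 0 :: real)"
      "graph_mat \<alpha> \<beta> *\<^sub>v (p \<cdot>\<^sub>v x + q \<cdot>\<^sub>v y) = \<theta> \<cdot>\<^sub>v (p \<cdot>\<^sub>v x + q \<cdot>\<^sub>v y)"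
      "\<And>v. v \<in> pverts G \<Longrightarrow> (\<alpha> + \<beta>) * card (parcs G `` {v}) \<noteq> \<theta>" for p q \<alpha> \<beta> \<theta> :: real
  proof -
    note eig = graph_mat_eigenvector_interior[OF X(1) _ _ that(2)[unfolded z]]
    have "p = 0" using eig[of u] that(3)[of u] u X(1) by (auto simp: two_valued_def)
    moreover have "q = 0"
      using eig[of w] that(3)[of w] w Y(1) by (auto simp: two_valued_def Y_def)
    ultimately show False using that(1) by simp
  qed
  \<comment> \<open>\<open>\<alpha> = 0\<close> is the adjacency matrix and
    \<open>\<alpha> = 1\<close> the signless Laplacian. The degree part of the form is at least
    \<open>(\<alpha> + 1) * \<delta>\<close> times the squared norm and the cut takes off at most
    \<open>\<tau>\<close> times it. As \<open>\<tau> > 0\<close>, \<open>\<theta>\<close> lies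
    strictly below all \<open>(\<alpha> + 1)\<close> multiples of degrees.\<close>
  have upper: "\<theta> < nth_largest_eigenvalue (graph_mat \<alpha> 1) 2"
    if "\<alpha> \<ge> 0" "\<theta> = (\<alpha> + 1) * \<delta> - \<tau>" for \<alpha> \<theta> :: real
  proof (rule ccontr)
    assume "\<not> ?thesis"
    then have le: "nth_largest_eigenvalue (graph_mat \<alpha> 1) 2 \<le> \<theta>" by simp
    have deg_le: "(\<alpha> + 1) * \<delta> \<le> (\<alpha> + 1) * card (parcs G `` {v})" if "v \<in> pverts G" for v
      using min_degree_le[OF that] \<open>\<alpha> \<ge> 0\<close> assms(6) by (intro mult_left_mono) auto
    have "\<theta> * (z' \<bullet> z') \<le> z' \<bullet> (graph_mat \<alpha> 1 *\<^sub>v z')" if z': "z' = p \<cdot>\<^sub>v x + q \<cdot>\<^sub>v y" for p q z'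
    proof -
      have "(\<alpha> + 1) * \<delta> * (card X * p\<^sup>2 + card Y * q\<^sup>2)
          = (\<Sum>v\<in>pverts G. (\<alpha> + 1) * \<delta> * (two_valued X p q v)\<^sup>2)"
        using sum_two_valued_squares[OF X(1), of p q]
        unfolding sum_distrib_left[symmetric] by (simp add: Y_def)
      also have "\<dots> \<le> (\<Sum>v\<in>pverts G. (\<alpha> + 1) * card (parcs G `` {v}) * (two_valued X p q v)\<^sup>2)"
        using deg_le by (intro sum_mono mult_right_mono) auto
      also have "\<dots> = (\<alpha> + 1) * (\<Sum>v\<in>pverts G. card (parcs G `` {v}) * (two_valued X p q v)\<^sup>2)"
        by (simp add: sum_distrib_left mult.assoc)
      finally show ?thesis
        unfolding z' z zz quad using bound[of p q] by (simp add: \<open>\<theta> = _\<close> left_diff_distrib)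
    qed
    then obtain p q where "(p, q) \<noteq> (0, 0)"
      "graph_mat \<alpha> 1 *\<^sub>v (p \<cdot>\<^sub>v x + q \<cdot>\<^sub>v y) = \<theta> \<cdot>\<^sub>v (p \<cdot>\<^sub>v x + q \<cdot>\<^sub>v y)"
      using eigenvector_in_plane_above[OF M graph_mat_symmetric n2 le xy] by metis
    then show False
    proof (rule no_eigenvector)
      fix v assume "v \<in> pverts G"
      then show "(\<alpha> + 1) * card (parcs G `` {v}) \<noteq> \<theta>"
        using deg_le[of v] \<tau>pos \<open>\<theta> = _\<close> by simp
    qed
  qed
  \<comment> \<open>For the Laplacian the degree part cancels: the form is just
    \<open>e * (p - q)\<^sup>2\<close>, and an interior row would give \<open>0 = \<tau>\<close>
    unless the vector vanishes there.\<close>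
  have lower: "nth_largest_eigenvalue (graph_mat 1 (-1)) (n - 1) < \<tau>"
  proof (rule ccontr)
    assume "\<not> ?thesis"
    then have ge: "nth_largest_eigenvalue (graph_mat 1 (-1)) (n - 1) \<ge> \<tau>" by simp
    have "z' \<bullet> (graph_mat 1 (-1) *\<^sub>v z') \<le> \<tau> * (z' \<bullet> z')" if z': "z' = p \<cdot>\<^sub>v x + q \<cdot>\<^sub>v y" for p q z'
      unfolding z' z zz quad using bound[of p q] by simp
    then obtain p q where "(p, q) \<noteq> (0, 0)"
      "graph_mat 1 (-1) *\<^sub>v (p \<cdot>\<^sub>v x + q \<cdot>\<^sub>v y) = \<tau> \<cdot>\<^sub>v (p \<cdot>\<^sub>v x + q \<cdot>\<^sub>v y)"
      using eigenvector_in_plane_below[OF M graph_mat_symmetric n2 ge xy] by metis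
    then show False by (rule no_eigenvector) (use \<tau>pos in simp)
  qed
  show ?thesis
    using upper[of 0 "real \<delta> - \<tau>"] upper[of 1 "2 * real \<delta> - \<tau>"] lower
    unfolding adj_eigenvalue_def lap_eigenvalue_def signless_lap_eigenvalue_def graph_mat_special
      \<tau>_def[symmetric] by auto
qed simp

end
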